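(* Let $C$ be a commutative unital ring in which $2$ is invertible. Let $A$ be a $C$-algebra with trace $\operatorname{tr}$. Let $\mathfrak{str}$ be the associated $\Sigma$-supertrace on $A\otimes_C\mathfrak{S}$, given by $\mathfrak{str}(a\otimes w)=\operatorname{tr}(a)\otimes w$, where $\mathfrak{S}$ is the free $\Sigma$-supercommutative $\Sigma$-superalgebra over $C$; and similarly let $\operatorname{str}$ be the supertrace on $A\otimes_C S$ given by $\operatorname{str}(a\otimes w)=\operatorname{tr}(a)\otimes w$, where $S$ is the free supercommutative algebra over $C$. Then the (ungraded) supertrace identities of $A\otimes_C S$ are the same as the (ungraded) $\Sigma$-supertrace identities of $A\otimes_C\mathfrak{S}$, with the formal symbol for the $\Sigma$-supertrace replaced by that for the supertrace. That is, an element of $C\langle X,\mathfrak{F}\rangle$ is an identity of $A\otimes_C S$ with linear function $\operatorname{str}$ if and only if it is an identity of $A\otimes_C\mathfrak{S}$ with linear function $\mathfrak{str}$.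
   Context: Algebras are associative, not necessarily unital. A trace on a $C$-algebra $A$ is a ($C$-linear) function $\operatorname{tr}:A\to\operatorname{Cent}(A)$ with $\operatorname{tr}([a,b])=0$ and $\operatorname{tr}(a\operatorname{tr}(b))=\operatorname{tr}(a)\operatorname{tr}(b)$ for all $a,b\in A$. Identities with linear function: $C\langle X,\mathfrak{F}\rangle$ is the free $C$-algebra on a countably infinite set $X$ with a $C$-linear function $\mathfrak{F}$ acting freely on it. For a $C$-algebra $B$ with a $C$-linear function $\mathfrak{f}:B\to B$, the identities of $B$ with linear function $\mathfrak{f}$ are the elements of the intersection of the kernels of all homomorphisms $\phi:C\langle X,\mathfrak{F}\rangle\to B$ such that $\phi(\mathfrak{F}(a))=\mathfrak{f}(\phi(a))$ for all $a$. The variables take values in all of $B$; no grading is respected. A superalgebra is a $\mathbb{Z}/2\mathbb{Z}$-graded algebra; the supercommutator of homogeneous elements is $\{x,y\}=xy-(-1)^{|x||y|}yx$. The free supercommutative algebra $S$ over $C$ is the (unital) superalgebra generated by countably many even generators $y_1,y_2,\dots$ and countably many odd generators $z_1,z_2,\dots$, whose only relations are $\{a,b\}=0$ for all $a,b\in S$. $C[\varepsilon]$ denotes the commutative unital $C$-algebra $C[\theta,\varepsilon_1,\varepsilon_2,\dots]$ subject to $\theta^2=2$ and $\varepsilon_i^2=\theta\varepsilon_i$ for all $i$. For $g=(g_i),h=(h_j)\in\mathbb{Z}_2^{\oplus\mathbb{N}}=\bigoplus_{i\in\mathbb{N}}\mathbb{Z}_2$, put $$\exp(\varepsilon_g\varepsilon_h)=\prod_{i:\,g_i=1}\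 \prod_{j:\,h_j=1}(1-\varepsilon_i\varepsilon_j)\in C[\varepsilon].$$ A $\Sigma$-superalgebra over $C$ is a $C[\varepsilon]$-algebra graded by $\mathbb{Z}_2^{\oplus\mathbb{N}}$; it is $\Sigma$-supercommutative if $ab=\exp(\varepsilon_g\varepsilon_h)ba$ for all $a$ of degree $g$ and $b$ of degree $h$. $\mathfrak{S}$ is the free $\Sigma$-supercommutative $\Sigma$-superalgebra: the unital $C[\varepsilon]$-algebra generated by $e_g^{(n)}$ ($g\in\mathbb{Z}_2^{\oplus\mathbb{N}}$, $n=1,2,\dots$), with $e_g^{(n)}$ homogeneous of degree $g$, under the relations $[e_g^{(n)},e_h^{(m)}]=(1-\exp(\varepsilon_g\varepsilon_h))e_g^{(n)}e_h^{(m)}$ for all $g,h,n,m$. *)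

theory Defs
  imports Complex_Main "HOL-Library.Poly_Mapping" "HOL-Library.Z2"
begin

section \<open>Algebras over a commutative ring, traces\<close>

text \<open>
  The base ring is a type \<open>'c :: comm_ring_1\<close>.  An associative, not necessarily unital algebra
  is a type \<open>'a :: ring\<close> together with an action of \<open>'c\<close>.
\<close>

locale c_algebra = module scale
  for scale :: "'c::comm_ring_1 \<Rightarrow> 'a::ring \<Rightarrow> 'a" +
  assumes scale_mult_left: "scale c x * y = scale c (x * y)"
    and scale_mult_right: "x * scale c y = scale c (x * y)"

definition Cent :: "'a::ring set" where
  "Cent = {z. \<forall>a. z * a = a * z}"

locale algebra_trace = c_algebra scale + module_hom scale scale tr
  for scale :: "'c::comm_ring_1 \<Rightarrow> 'a::ring \<Rightarrow> 'a" and tr :: "'a \<Rightarrow> 'a" +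
  assumes trace_central: "tr a \<in> Cent"
    and trace_commutator: "tr (a * b - b * a) = 0"
    and trace_trace: "tr (a * tr b) = tr a * tr b"


section \<open>Free modules and free monoids\<close>

text \<open>
  \<open>'k \<Rightarrow>\<^sub>0 'c\<close> is the free module on \<open>'k\<close>.  When \<open>'k\<close> is a monoid (written additively),
  multiplication of \<open>'k \<Rightarrow>\<^sub>0 'c\<close> is convolution, so that \<open>'x word \<Rightarrow>\<^sub>0 'c\<close> is the free unital
  algebra on \<open>'x\<close>, and \<open>('x \<Rightarrow>\<^sub>0 nat) \<Rightarrow>\<^sub>0 'c\<close> is the polynomial ring on \<open>'x\<close>.
\<close>

abbreviation lookup :: "('k \<Rightarrow>\<^sub>0 'c::zero) \<Rightarrow> 'k \<Rightarrow> 'c" where "lookup \<equiv> Poly_Mapping.lookup"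
abbreviation keys :: "('k \<Rightarrow>\<^sub>0 'c::zero) \<Rightarrow> 'k set" where "keys \<equiv> Poly_Mapping.keys"
abbreviation single :: "'k \<Rightarrow> 'c \<Rightarrow> 'k \<Rightarrow>\<^sub>0 'c::zero" where "single \<equiv> Poly_Mapping.single"

definition fscale :: "'c::comm_ring_1 \<Rightarrow> ('k \<Rightarrow>\<^sub>0 'c) \<Rightarrow> ('k \<Rightarrow>\<^sub>0 'c)" where
  "fscale c p = Poly_Mapping.map ((*) c) p"

lemma lookup_fscale [simp]: "lookup (fscale c p) k = c * lookup p k"
  unfolding fscale_def by transfer (simp add: when_def)

lemma poly_mapping_add_induct [case_names zero single add]:
  assumes "P 0" "\<And>k c. P (single k c)" "\<And>p q. P p \<Longrightarrow> P q \<Longrightarrow> P (p + q)"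
  shows "P (p :: 'k \<Rightarrow>\<^sub>0 'c::comm_ring_1)"
proof (induction p rule: Poly_Mapping.update_induct)
  case const
  show ?case by (rule assms)
next
  case (update f a b)
  have "Poly_Mapping.update a b f = f + single a b"
    using update(1)
    by (intro poly_mapping_eqI) (auto simp: lookup_update lookup_add lookup_single in_keys_iff when_def)
  then show ?case using update assms by simp
qed

lemma module_fscale: "module fscale"
  by unfold_locales (auto intro!: poly_mapping_eqI simp: lookup_add algebra_simps)

datatype 'x word = Word "'x list"

instantiation word :: (type) monoid_add
begin

definition zero_word :: "'a word" where
  "0 = Word []"

fun plus_word :: "'a word \<Rightarrow> 'a word \<Rightarrow> 'a word" where
  "Word xs + Word ys = Word (xs @ ys)"

instance
proof
  fix a b c :: "'a word"
  show "a + b + c = a + (b + c)" by (cases a; cases b; cases c) simp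
  show "0 + a = a" by (cases a) (simp add: zero_word_def)
  show "a + 0 = a" by (cases a) (simp add: zero_word_def)
qed

end

abbreviation gen :: "'x \<Rightarrow> 'x word \<Rightarrow>\<^sub>0 'c::comm_ring_1" where
  "gen x \<equiv> single (Word [x]) 1"

lemma word_add_eq_0_iff: "0 = a + b \<longleftrightarrow> a = 0 \<and> b = (0 :: 'x word)"
  by (cases a; cases b) (auto simp: zero_word_def)

lemma lookup_mult_word_0:
  fixes p q :: "'x word \<Rightarrow>\<^sub>0 'c::comm_ring_1"
  shows "lookup (p * q) 0 = lookup p 0 * lookup q 0"
proof -
  have "(\<Sum>r. lookup q r when 0 = l + r) = (lookup q 0 when l = 0)" for l
    by (cases "l = 0") (simp_all add: word_add_eq_0_iff)
  then show ?thesis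
    by (simp add: lookup_mult mult_when)
qed


section \<open>Two-sided ideals\<close>

inductive_set ideal_gen :: "'r::ring_1 set \<Rightarrow> 'r set" for G where
  zero: "0 \<in> ideal_gen G"
| gen: "g \<in> G \<Longrightarrow> g \<in> ideal_gen G"
| add: "x \<in> ideal_gen G \<Longrightarrow> y \<in> ideal_gen G \<Longrightarrow> x + y \<in> ideal_gen G"
| mult_left: "x \<in> ideal_gen G \<Longrightarrow> r * x \<in> ideal_gen G"
| mult_right: "x \<in> ideal_gen G \<Longrightarrow> x * r \<in> ideal_gen G"

definition ideal_cong :: "'r::ring_1 set \<Rightarrow> 'r \<Rightarrow> 'r \<Rightarrow> bool" where
  "ideal_cong G x y \<longleftrightarrow> x - y \<in> ideal_gen G"

lemma ideal_gen_uminus: "x \<in> ideal_gen G \<Longrightarrow> - x \<in> ideal_gen G"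
  using ideal_gen.mult_left [of x G "-1"] by simp

lemma ideal_cong_refl: "ideal_cong G x x"
  by (simp add: ideal_cong_def ideal_gen.zero)

lemma ideal_cong_sym: "ideal_cong G x y \<Longrightarrow> ideal_cong G y x"
  using ideal_gen_uminus [of "x - y" G] by (simp add: ideal_cong_def)

lemma ideal_cong_trans: "ideal_cong G x y \<Longrightarrow> ideal_cong G y z \<Longrightarrow> ideal_cong G x z"
  using ideal_gen.add [of "x - y" G "y - z"] by (simp add: ideal_cong_def)

lemma equivp_ideal_cong: "equivp (ideal_cong G)"
  by (rule equivpI) (auto intro: reflpI sympI transpI ideal_cong_refl ideal_cong_sym ideal_cong_trans)

lemma ideal_cong_add:
  "ideal_cong G x x' \<Longrightarrow> ideal_cong G y y' \<Longrightarrow> ideal_cong G (x + y) (x' + y')"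
  using ideal_gen.add [of "x - x'" G "y - y'"] by (simp add: ideal_cong_def algebra_simps)

lemma ideal_cong_uminus: "ideal_cong G x x' \<Longrightarrow> ideal_cong G (- x) (- x')"
  using ideal_gen_uminus [of "x - x'" G] by (simp add: ideal_cong_def)

lemma ideal_cong_diff:
  "ideal_cong G x x' \<Longrightarrow> ideal_cong G y y' \<Longrightarrow> ideal_cong G (x - y) (x' - y')"
  using ideal_cong_add [of G x x' "- y" "- y'"] by (simp add: ideal_cong_uminus)

lemma ideal_cong_mult:
  assumes "ideal_cong G x x'" "ideal_cong G y y'"
  shows "ideal_cong G (x * y) (x' * y')"
proof -
  have "(x - x') * y + x' * (y - y') \<in> ideal_gen G"
    using assms unfolding ideal_cong_def
    by (intro ideal_gen.add ideal_gen.mult_left ideal_gen.mult_right)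
  then show ?thesis by (simp add: ideal_cong_def algebra_simps)
qed


section \<open>The free supercommutative algebra \<open>S\<close>\<close>

datatype sgen = Even nat | Odd nat

fun odd_count :: "sgen word \<Rightarrow> nat" where
  "odd_count (Word xs) = length (filter (\<lambda>x. \<exists>i. x = Odd i) xs)"

text \<open>
  The free unital algebra on \<open>sgen\<close> is graded by the parity of the number of odd generators.  The
  degree in \<open>homogeneous\<close> matters only modulo 2.  Homogeneous elements of the quotient are the
  images of homogeneous elements, so the relations below say that all supercommutators vanish.
\<close>

definition homogeneous :: "nat \<Rightarrow> (sgen word \<Rightarrow>\<^sub>0 'c::comm_ring_1) \<Rightarrow> bool" where
  "homogeneous i p \<longleftrightarrow> (\<forall>w\<in>keys p. odd_count w mod 2 = i mod 2)"

definition supercommutators :: "(sgen word \<Rightarrow>\<^sub>0 'c::comm_ring_1) set" where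
  "supercommutators = {a * b - (-1) ^ (i * j) * (b * a) | a b i j. homogeneous i a \<and> homogeneous j b}"

quotient_type (overloaded) 'c free_scomm = "sgen word \<Rightarrow>\<^sub>0 'c::comm_ring_1" / "ideal_cong supercommutators"
  by (rule equivp_ideal_cong)

lemma lookup_supercommutators_0:
  fixes p :: "sgen word \<Rightarrow>\<^sub>0 'c::comm_ring_1"
  assumes "p \<in> supercommutators"
  shows "lookup p 0 = 0"
proof -
  obtain a b :: "sgen word \<Rightarrow>\<^sub>0 'c" and i j
    where p: "p = a * b - (-1) ^ (i * j) * (b * a)" and h: "homogeneous i a" "homogeneous j b"
    using assms by (auto simp: supercommutators_def)
  have odd0: "lookup a 0 = 0" if "homogeneous i a" "odd i" for a :: "sgen word \<Rightarrow>\<^sub>0 'c" and i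
    using that in_keys_iff [of 0 a]
    by (auto simp: homogeneous_def zero_word_def odd_iff_mod_2_eq_one dest!: bspec)
  have "lookup ((-1) ^ (i * j) * (b * a)) 0 = lookup (a * b) 0"
  proof (cases "odd i \<and> odd j")
    case True
    then show ?thesis using odd0 h by (simp add: lookup_mult_word_0)
  next
    case False
    then have "(-1) ^ (i * j) = (1 :: sgen word \<Rightarrow>\<^sub>0 'c)" by auto
    then show ?thesis by (simp add: lookup_mult_word_0 mult.commute)
  qed
  then show ?thesis by (simp add: p lookup_minus)
qed

lemma lookup_ideal_gen_0:
  fixes p :: "'x word \<Rightarrow>\<^sub>0 'c::comm_ring_1"
  assumes "p \<in> ideal_gen G" and "\<And>g. g \<in> G \<Longrightarrow> lookup g 0 = 0"
  shows "lookup p 0 = 0"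
  using assms by induction (auto simp: lookup_add lookup_mult_word_0)

instantiation free_scomm :: (comm_ring_1) ring_1
begin

lift_definition zero_free_scomm :: "'a free_scomm" is 0 .
lift_definition one_free_scomm :: "'a free_scomm" is 1 .
lift_definition plus_free_scomm :: "'a free_scomm \<Rightarrow> 'a free_scomm \<Rightarrow> 'a free_scomm" is "(+)"
  by (rule ideal_cong_add)
lift_definition uminus_free_scomm :: "'a free_scomm \<Rightarrow> 'a free_scomm" is uminus
  by (rule ideal_cong_uminus)
lift_definition minus_free_scomm :: "'a free_scomm \<Rightarrow> 'a free_scomm \<Rightarrow> 'a free_scomm" is "(-)"
  by (rule ideal_cong_diff)
lift_definition times_free_scomm :: "'a free_scomm \<Rightarrow> 'a free_scomm \<Rightarrow> 'a free_scomm" is "(*)"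
  by (rule ideal_cong_mult)

instance
proof
  show "(0 :: 'a free_scomm) \<noteq> 1"
  proof (transfer, rule notI)
    assume "ideal_cong supercommutators (0 :: sgen word \<Rightarrow>\<^sub>0 'a) 1"
    then have "0 - (1 :: sgen word \<Rightarrow>\<^sub>0 'a) \<in> ideal_gen supercommutators"
      by (simp only: ideal_cong_def)
    from lookup_ideal_gen_0 [OF this lookup_supercommutators_0] show False by simp
  qed
qed (transfer; simp add: ideal_cong_refl algebra_simps)+

end

lift_definition scale_S :: "'c::comm_ring_1 \<Rightarrow> 'c free_scomm \<Rightarrow> 'c free_scomm" is
  "\<lambda>c p. single 0 c * p"
  by (intro ideal_cong_mult ideal_cong_refl)


section \<open>The ring \<open>C[\<epsilon>]\<close>\<close>

datatype epsgen = Theta | Eps nat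

abbreviation poly_theta :: "(epsgen \<Rightarrow>\<^sub>0 nat) \<Rightarrow>\<^sub>0 'c::comm_ring_1" where
  "poly_theta \<equiv> single (single Theta 1) 1"

abbreviation poly_eps :: "nat \<Rightarrow> (epsgen \<Rightarrow>\<^sub>0 nat) \<Rightarrow>\<^sub>0 'c::comm_ring_1" where
  "poly_eps i \<equiv> single (single (Eps i) 1) 1"

definition ceps_relations :: "((epsgen \<Rightarrow>\<^sub>0 nat) \<Rightarrow>\<^sub>0 'c::comm_ring_1) set" where
  "ceps_relations = {poly_theta\<^sup>2 - 2} \<union> {(poly_eps i)\<^sup>2 - poly_theta * poly_eps i | i. True}"

quotient_type (overloaded) 'c ceps = "(epsgen \<Rightarrow>\<^sub>0 nat) \<Rightarrow>\<^sub>0 'c::comm_ring_1" / "ideal_cong ceps_relations"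
  by (rule equivp_ideal_cong)

text \<open>
  The type class \<open>comm_ring_1\<close> asks for \<open>0 \<noteq> 1\<close> in the quotient.  This is witnessed by the linear
  functional that kills every \<open>\<epsilon>\<^sub>i\<close>, sends \<open>\<theta>\<^sup>2\<^sup>k\<close> to \<open>2\<^sup>k\<close>, and kills odd powers of \<open>\<theta>\<close>.
\<close>

definition ceps_weight :: "(epsgen \<Rightarrow>\<^sub>0 nat) \<Rightarrow> 'c::comm_ring_1" where
  "ceps_weight m = (if (\<exists>i. lookup m (Eps i) \<noteq> 0) \<or> odd (lookup m Theta) then 0
     else 2 ^ (lookup m Theta div 2))"

definition ceps_functional :: "((epsgen \<Rightarrow>\<^sub>0 nat) \<Rightarrow>\<^sub>0 'c::comm_ring_1) \<Rightarrow> 'c" where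
  "ceps_functional p = (\<Sum>m\<in>keys p. lookup p m * ceps_weight m)"

lemma ceps_functional_add: "ceps_functional (p + q) = ceps_functional p + ceps_functional q"
  unfolding ceps_functional_def
  by (rule setsum_keys_plus_distrib) (simp_all add: algebra_simps)

lemma ceps_functional_single: "ceps_functional (single m c) = c * ceps_weight m"
  by (simp add: ceps_functional_def)

lemma ceps_functional_diff: "ceps_functional (p - q) = ceps_functional p - ceps_functional q"
  using ceps_functional_add [of "p - q" q] by simp

lemma ceps_functional_relation:
  fixes g :: "(epsgen \<Rightarrow>\<^sub>0 nat) \<Rightarrow>\<^sub>0 'c::comm_ring_1"
  assumes "g \<in> ceps_relations"
  shows "ceps_functional (q * g) = 0"
proof (induction q rule: poly_mapping_add_induct)
  case (single k v)
  have w1: "ceps_weight (k + single Theta 2) = 2 * (ceps_weight k :: 'c)"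
    by (auto simp: ceps_weight_def lookup_add lookup_single when_def)
  have w2: "ceps_weight (k + single (Eps i) n + l) = (0 :: 'c)" if "n > 0" for i n l
  proof -
    have "lookup (k + single (Eps i) n + l) (Eps i) \<noteq> 0"
      using that by (simp add: lookup_add)
    then show ?thesis by (auto simp: ceps_weight_def)
  qed
  have two: "single k v * 2 = single k (v * 2)"
    using mult_single [of k v 0 2] by simp
  from assms consider "g = single (single Theta 2) 1 - 2"
    | i where "g = single (single (Eps i) 2) 1
        - single (single (Eps i) 1 + single Theta 1) 1"
    by (auto simp: ceps_relations_def power2_eq_square mult_single add.commute numeral_2_eq_2
        simp flip: single_add)
  then show ?case
  proof cases
    case 1
    then show ?thesis
      by (simp add: right_diff_distrib ceps_functional_diff mult_single ceps_functional_single w1 two)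
  next
    case 2
    then show ?thesis
      using w2 [of 2 i 0] w2 [of 1 i "single Theta 1"]
      by (simp add: right_diff_distrib ceps_functional_diff mult_single ceps_functional_single
          add.assoc)
  qed
qed (simp_all add: distrib_right ceps_functional_add ceps_functional_def [of 0])

lemma ceps_functional_ideal:
  assumes "p \<in> ideal_gen ceps_relations"
  shows "ceps_functional (q * p) = 0"
  using assms
proof (induction arbitrary: q)
  case (mult_right x r)
  then show ?case by (metis mult.assoc mult.commute)
qed (simp_all add: ceps_functional_def [of 0] ceps_functional_relation distrib_left
    ceps_functional_add flip: mult.assoc)

instantiation ceps :: (comm_ring_1) comm_ring_1
begin

lift_definition zero_ceps :: "'a ceps" is 0 .
lift_definition one_ceps :: "'a ceps" is 1 .
lift_definition plus_ceps :: "'a ceps \<Rightarrow> 'a ceps \<Rightarrow> 'a ceps" is "(+)"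
  by (rule ideal_cong_add)
lift_definition uminus_ceps :: "'a ceps \<Rightarrow> 'a ceps" is uminus
  by (rule ideal_cong_uminus)
lift_definition minus_ceps :: "'a ceps \<Rightarrow> 'a ceps \<Rightarrow> 'a ceps" is "(-)"
  by (rule ideal_cong_diff)
lift_definition times_ceps :: "'a ceps \<Rightarrow> 'a ceps \<Rightarrow> 'a ceps" is "(*)"
  by (rule ideal_cong_mult)

instance
proof
  show "(0 :: 'a ceps) \<noteq> 1"
  proof (transfer, rule notI)
    assume "ideal_cong ceps_relations (0 :: (epsgen \<Rightarrow>\<^sub>0 nat) \<Rightarrow>\<^sub>0 'a) 1"
    then have "(1 :: (epsgen \<Rightarrow>\<^sub>0 nat) \<Rightarrow>\<^sub>0 'a) \<in> ideal_gen ceps_relations"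
      using ideal_gen_uminus by (force simp: ideal_cong_def)
    from ceps_functional_ideal [OF this, of 1] show False
      using ceps_functional_single [of 0 "1 :: 'a"] by (simp add: ceps_weight_def)
  qed
qed (transfer; simp add: ideal_cong_refl algebra_simps)+

end

lift_definition ceps_const :: "'c::comm_ring_1 \<Rightarrow> 'c ceps" is "single 0" .

lift_definition eps :: "nat \<Rightarrow> 'c::comm_ring_1 ceps" is poly_eps .

text \<open>\<open>nat \<Rightarrow>\<^sub>0 bit\<close> is the direct sum of countably many copies of the integers modulo 2.\<close>

definition exp_eps :: "(nat \<Rightarrow>\<^sub>0 bit) \<Rightarrow> (nat \<Rightarrow>\<^sub>0 bit) \<Rightarrow> 'c::comm_ring_1 ceps" where
  "exp_eps g h = (\<Prod>i | lookup g i = 1. \<Prod>j | lookup h j = 1. 1 - eps i * eps j)"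


section \<open>The free \<open>\<Sigma>\<close>-supercommutative \<open>\<Sigma>\<close>-superalgebra\<close>

text \<open>
  The grading by \<open>nat \<Rightarrow>\<^sub>0 bit\<close> enters only through the relations, since identities are ungraded.
  \<open>E g n\<close> is the \<open>n\<close>-th generator of degree \<open>g\<close>, counting from 0.
\<close>

datatype sigma_gen = E "nat \<Rightarrow>\<^sub>0 bit" nat

definition sigma_relations :: "(sigma_gen word \<Rightarrow>\<^sub>0 'c::comm_ring_1 ceps) set" where
  "sigma_relations =
    {(gen (E g n) * gen (E h m) - gen (E h m) * gen (E g n))
       - single 0 (1 - exp_eps g h) * (gen (E g n) * gen (E h m)) | g h n m. True}"

quotient_type (overloaded) 'c free_sigma = "sigma_gen word \<Rightarrow>\<^sub>0 'c::comm_ring_1 ceps" / "ideal_cong sigma_relations"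
  by (rule equivp_ideal_cong)

lemma lookup_sigma_relations_0: "p \<in> sigma_relations \<Longrightarrow> lookup p 0 = 0"
  by (auto simp: sigma_relations_def lookup_minus lookup_mult_word_0 lookup_single)
    (simp_all add: zero_word_def)

instantiation free_sigma :: (comm_ring_1) ring_1
begin

lift_definition zero_free_sigma :: "'a free_sigma" is 0 .
lift_definition one_free_sigma :: "'a free_sigma" is 1 .
lift_definition plus_free_sigma :: "'a free_sigma \<Rightarrow> 'a free_sigma \<Rightarrow> 'a free_sigma" is "(+)"
  by (rule ideal_cong_add)
lift_definition uminus_free_sigma :: "'a free_sigma \<Rightarrow> 'a free_sigma" is uminus
  by (rule ideal_cong_uminus)
lift_definition minus_free_sigma :: "'a free_sigma \<Rightarrow> 'a free_sigma \<Rightarrow> 'a free_sigma" is "(-)"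
  by (rule ideal_cong_diff)
lift_definition times_free_sigma :: "'a free_sigma \<Rightarrow> 'a free_sigma \<Rightarrow> 'a free_sigma" is "(*)"
  by (rule ideal_cong_mult)

instance
proof
  show "(0 :: 'a free_sigma) \<noteq> 1"
  proof (transfer, rule notI)
    assume "ideal_cong sigma_relations (0 :: sigma_gen word \<Rightarrow>\<^sub>0 'a ceps) 1"
    then have "0 - (1 :: sigma_gen word \<Rightarrow>\<^sub>0 'a ceps) \<in> ideal_gen sigma_relations"
      by (simp only: ideal_cong_def)
    from lookup_ideal_gen_0 [OF this lookup_sigma_relations_0] show False by simp
  qed
qed (transfer; simp add: ideal_cong_refl algebra_simps)+

end

lift_definition scale_Sigma :: "'c::comm_ring_1 \<Rightarrow> 'c free_sigma \<Rightarrow> 'c free_sigma" is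
  "\<lambda>c p. single 0 (ceps_const c) * p"
  by (intro ideal_cong_mult ideal_cong_refl)


section \<open>Tensor products\<close>

text \<open>
  The underlying set of a tensor product depends on the actions of \<open>'c\<close>, which are terms; hence
  it cannot be a type, and algebras on a carrier set are needed.
\<close>

record ('c, 'b) alg =
  carrier :: "'b set"
  zero :: 'b
  add :: "'b \<Rightarrow> 'b \<Rightarrow> 'b"
  mult :: "'b \<Rightarrow> 'b \<Rightarrow> 'b"
  smult :: "'c \<Rightarrow> 'b \<Rightarrow> 'b"

context
  fixes sA :: "'c::comm_ring_1 \<Rightarrow> 'a::ring \<Rightarrow> 'a" and sB :: "'c \<Rightarrow> 'b::ring \<Rightarrow> 'b"
begin

definition tensor_relations :: "('a \<times> 'b \<Rightarrow>\<^sub>0 'c) set" where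
  "tensor_relations =
     (let t = (\<lambda>a b. single (a, b) 1) in
      {t (a + a') b - t a b - t a' b | a a' b. True} \<union>
      {t a (b + b') - t a b - t a b' | a b b'. True} \<union>
      {t (sA c a) b - fscale c (t a b) | c a b. True} \<union>
      {t a (sB c b) - fscale c (t a b) | c a b. True})"

definition tensor_class :: "('a \<times> 'b \<Rightarrow>\<^sub>0 'c) \<Rightarrow> ('a \<times> 'b \<Rightarrow>\<^sub>0 'c) set" where
  "tensor_class p = {q. q - p \<in> module.span fscale tensor_relations}"

definition pre_mult :: "('a \<times> 'b \<Rightarrow>\<^sub>0 'c) \<Rightarrow> ('a \<times> 'b \<Rightarrow>\<^sub>0 'c) \<Rightarrow> ('a \<times> 'b \<Rightarrow>\<^sub>0 'c)" where
  "pre_mult p q = (\<Sum>(a, b)\<in>keys p. \<Sum>(a', b')\<in>keys q.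
     single (a * a', b * b') (lookup p (a, b) * lookup q (a', b')))"

definition tensor :: "('c, ('a \<times> 'b \<Rightarrow>\<^sub>0 'c) set) alg" where
  "tensor = \<lparr>
     carrier = range tensor_class,
     zero = tensor_class 0,
     add = (\<lambda>P Q. \<Union>p\<in>P. \<Union>q\<in>Q. tensor_class (p + q)),
     mult = (\<lambda>P Q. \<Union>p\<in>P. \<Union>q\<in>Q. tensor_class (pre_mult p q)),
     smult = (\<lambda>c P. \<Union>p\<in>P. tensor_class (fscale c p))\<rparr>"

text \<open>The map \<open>f \<otimes> id\<close>, for a linear map \<open>f\<close> on the left factor.\<close>

definition tensor_map_left ::
    "('a \<Rightarrow> 'a) \<Rightarrow> ('a \<times> 'b \<Rightarrow>\<^sub>0 'c) set \<Rightarrow> ('a \<times> 'b \<Rightarrow>\<^sub>0 'c) set" where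
  "tensor_map_left f P = (\<Union>p\<in>P. tensor_class
     (\<Sum>(a, b)\<in>keys p. single (f a, b) (lookup p (a, b))))"

end

text \<open>
  The operations are well defined: they are determined by their values on representatives.
\<close>

interpretation fmod: module fscale
  by (rule module_fscale)

lemma fscale_single: "fscale c (single k d) = single k (c * d)"
  by (rule poly_mapping_eqI) (simp add: lookup_single when_def)

lemma pre_mult_add_left: "pre_mult (p + p') q = pre_mult p q + pre_mult p' q"
  using setsum_keys_plus_distrib [of "\<lambda>x v. \<Sum>y\<in>keys q.
      single (fst x * fst y, snd x * snd y) (v * lookup q y)" p p']
  by (simp add: pre_mult_def split_def distrib_right single_add sum.distrib)

lemma pre_mult_add_right: "pre_mult p (q + q') = pre_mult p q + pre_mult p q'"
proof -
  have "(\<Sum>y\<in>keys (q + q'). single (fst x * fst y, snd x * snd y) (lookup p x * lookup (q + q') y)) =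
      (\<Sum>y\<in>keys q. single (fst x * fst y, snd x * snd y) (lookup p x * lookup q y)) +
      (\<Sum>y\<in>keys q'. single (fst x * fst y, snd x * snd y) (lookup p x * lookup q' y))" for x
    by (rule setsum_keys_plus_distrib [of "\<lambda>y v.
        single (fst x * fst y, snd x * snd y) (lookup p x * v)" q q'])
      (simp_all add: distrib_left single_add)
  then show ?thesis
    by (simp add: pre_mult_def split_def sum.distrib)
qed

lemma pre_mult_single:
  "pre_mult (single (a, b) c) (single (a', b') c') = single (a * a', b * b') (c * c')"
  by (simp add: pre_mult_def)

lemma pre_mult_zero_left [simp]: "pre_mult 0 q = 0"
  and pre_mult_zero_right [simp]: "pre_mult p 0 = 0"
  by (simp_all add: pre_mult_def)

lemma pre_mult_diff_left: "pre_mult (p - p') q = pre_mult p q - pre_mult p' q"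
  using pre_mult_add_left [of "p - p'" p' q] by simp

lemma pre_mult_diff_right: "pre_mult p (q - q') = pre_mult p q - pre_mult p q'"
  using pre_mult_add_right [of p "q - q'" q'] by simp

lemma pre_mult_fscale_left: "pre_mult (fscale c p) q = fscale c (pre_mult p q)"
proof (induction p rule: poly_mapping_add_induct)
  case (single k d)
  show ?case
  proof (induction q rule: poly_mapping_add_induct)
    case (single k' d')
    then show ?case
      by (cases k; cases k') (simp add: pre_mult_single fscale_single mult.assoc)
  qed (simp_all add: pre_mult_add_right fmod.scale_right_distrib)
qed (simp_all add: pre_mult_add_left fmod.scale_right_distrib)

lemma pre_mult_fscale_right: "pre_mult p (fscale c q) = fscale c (pre_mult p q)"
proof (induction p rule: poly_mapping_add_induct)
  case (single k d)
  show ?case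
  proof (induction q rule: poly_mapping_add_induct)
    case (single k' d')
    then show ?case
      by (cases k; cases k') (simp add: pre_mult_single fscale_single mult.left_commute)
  qed (simp_all add: pre_mult_add_right fmod.scale_right_distrib)
qed (simp_all add: pre_mult_add_left fmod.scale_right_distrib)

lemma tensor_relations_cases:
  assumes "r \<in> tensor_relations sA sB"
  obtains
    a a' b where "r = single (a + a', b) 1 - single (a, b) 1 - single (a', b) 1"
  | a b b' where "r = single (a, b + b') 1 - single (a, b) 1 - single (a, b') 1"
  | c a b where "r = single (sA c a, b) 1 - fscale c (single (a, b) 1)"
  | c a b where "r = single (a, sB c b) 1 - fscale c (single (a, b) 1)"
  using assms unfolding tensor_relations_def Let_def by blast

lemma tensor_relationsI:
  "single (a + a', b) 1 - single (a, b) 1 - single (a', b) 1 \<in> tensor_relations sA sB"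
  "single (a, b + b') 1 - single (a, b) 1 - single (a, b') 1 \<in> tensor_relations sA sB"
  "single (sA c a, b) 1 - fscale c (single (a, b) 1) \<in> tensor_relations sA sB"
  "single (a, sB c b) 1 - fscale c (single (a, b) 1) \<in> tensor_relations sA sB"
  unfolding tensor_relations_def Let_def by blast+

lemma tensor_class_eq_iff:
  "tensor_class sA sB p = tensor_class sA sB q \<longleftrightarrow> p - q \<in> fmod.span (tensor_relations sA sB)"
proof
  assume "tensor_class sA sB p = tensor_class sA sB q"
  moreover have "p \<in> tensor_class sA sB p" by (simp add: tensor_class_def fmod.span_zero)
  ultimately show "p - q \<in> fmod.span (tensor_relations sA sB)" by (simp add: tensor_class_def)
next
  assume *: "p - q \<in> fmod.span (tensor_relations sA sB)"
  show "tensor_class sA sB p = tensor_class sA sB q"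
    using fmod.span_add [OF _ *] fmod.span_diff [OF _ *]
    by (force simp: tensor_class_def)
qed

lemma tensor_class_UN:
  assumes "\<And>p'. p' - p \<in> fmod.span (tensor_relations sA sB) \<Longrightarrow>
      h p' - h p \<in> fmod.span (tensor_relations sA sB)"
  shows "(\<Union>p'\<in>tensor_class sA sB p. tensor_class sA sB (h p')) = tensor_class sA sB (h p)"
proof -
  have "tensor_class sA sB (h p') = tensor_class sA sB (h p)" if "p' \<in> tensor_class sA sB p" for p'
    using that assms by (simp add: tensor_class_eq_iff) (simp add: tensor_class_def)
  moreover have "p \<in> tensor_class sA sB p" by (simp add: tensor_class_def fmod.span_zero)
  ultimately show ?thesis by blast
qed

lemma add_tensor_class:
  "add (tensor sA sB) (tensor_class sA sB p) (tensor_class sA sB q) = tensor_class sA sB (p + q)"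
proof -
  have "(\<Union>q'\<in>tensor_class sA sB q. tensor_class sA sB (p' + q')) = tensor_class sA sB (p' + q)" for p'
    by (rule tensor_class_UN) simp
  moreover have "(\<Union>p'\<in>tensor_class sA sB p. tensor_class sA sB (p' + q)) = tensor_class sA sB (p + q)"
    by (rule tensor_class_UN [where h = "\<lambda>p'. p' + q"]) simp
  ultimately show ?thesis by (simp add: tensor_def)
qed

lemma smult_tensor_class:
  "smult (tensor sA sB) c (tensor_class sA sB p) = tensor_class sA sB (fscale c p)"
  unfolding tensor_def
  by (simp, rule tensor_class_UN) (simp add: fmod.span_scale flip: fmod.scale_right_diff_distrib)

lemma pre_mult_span_left:
  assumes A: "c_algebra sA" and B: "c_algebra sB" and p: "p \<in> fmod.span (tensor_relations sA sB)"
  shows "pre_mult p q \<in> fmod.span (tensor_relations sA sB)"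
proof (induction q rule: poly_mapping_add_induct)
  case (single k c)
  obtain x y where k: "k = (x, y)" by (cases k)
  note R = fmod.span_scale [OF fmod.span_base, of _ "tensor_relations sA sB" c]
  show ?case
    using p
  proof (induction rule: fmod.span_induct_alt)
    case (step d r p)
    from step(1) have "pre_mult r (single k c) \<in> fmod.span (tensor_relations sA sB)"
    proof (cases rule: tensor_relations_cases)
      case (1 a a' b)
      show ?thesis
        using R [OF tensor_relationsI(1) [of "a * x" "a' * x" "b * y"]]
        by (simp add: 1 k pre_mult_diff_left pre_mult_single fscale_single distrib_right
            fmod.scale_right_diff_distrib)
    next
      case (2 a b b')
      show ?thesis
        using R [OF tensor_relationsI(2) [of "a * x" "b * y" "b' * y"]]
        by (simp add: 2 k pre_mult_diff_left pre_mult_single fscale_single distrib_right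
            fmod.scale_right_diff_distrib)
    next
      case (3 e a b)
      show ?thesis
        using R [OF tensor_relationsI(3) [of sA e "a * x" "b * y"]]
        by (simp add: 3 k pre_mult_diff_left pre_mult_single fscale_single
            fmod.scale_right_diff_distrib c_algebra.scale_mult_left [OF A] mult.commute)
    next
      case (4 e a b)
      show ?thesis
        using R [OF tensor_relationsI(4) [of "a * x" sB e "b * y"]]
        by (simp add: 4 k pre_mult_diff_left pre_mult_single fscale_single
            fmod.scale_right_diff_distrib c_algebra.scale_mult_left [OF B] mult.commute)
    qed
    then show ?case
      using step by (simp add: pre_mult_add_left pre_mult_fscale_left fmod.span_add fmod.span_scale)
  qed (simp add: fmod.span_zero)
qed (simp_all add: pre_mult_add_right fmod.span_add fmod.span_zero)

lemma pre_mult_span_right: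
  assumes A: "c_algebra sA" and B: "c_algebra sB" and q: "q \<in> fmod.span (tensor_relations sA sB)"
  shows "pre_mult p q \<in> fmod.span (tensor_relations sA sB)"
proof (induction p rule: poly_mapping_add_induct)
  case (single k c)
  obtain x y where k: "k = (x, y)" by (cases k)
  note R = fmod.span_scale [OF fmod.span_base, of _ "tensor_relations sA sB" c]
  show ?case
    using q
  proof (induction rule: fmod.span_induct_alt)
    case (step d r q)
    from step(1) have "pre_mult (single k c) r \<in> fmod.span (tensor_relations sA sB)"
    proof (cases rule: tensor_relations_cases)
      case (1 a a' b)
      show ?thesis
        using R [OF tensor_relationsI(1) [of "x * a" "x * a'" "y * b"]]
        by (simp add: 1 k pre_mult_diff_right pre_mult_single fscale_single distrib_left
            fmod.scale_right_diff_distrib)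
    next
      case (2 a b b')
      show ?thesis
        using R [OF tensor_relationsI(2) [of "x * a" "y * b" "y * b'"]]
        by (simp add: 2 k pre_mult_diff_right pre_mult_single fscale_single distrib_left
            fmod.scale_right_diff_distrib)
    next
      case (3 e a b)
      show ?thesis
        using R [OF tensor_relationsI(3) [of sA e "x * a" "y * b"]]
        by (simp add: 3 k pre_mult_diff_right pre_mult_single fscale_single
            fmod.scale_right_diff_distrib c_algebra.scale_mult_right [OF A] mult.commute)
    next
      case (4 e a b)
      show ?thesis
        using R [OF tensor_relationsI(4) [of "x * a" sB e "y * b"]]
        by (simp add: 4 k pre_mult_diff_right pre_mult_single fscale_single
            fmod.scale_right_diff_distrib c_algebra.scale_mult_right [OF B] mult.commute)
    qed
    then show ?case
      using step by (simp add: pre_mult_add_right pre_mult_fscale_right fmod.span_add fmod.span_scale)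
  qed (simp add: fmod.span_zero)
qed (simp_all add: pre_mult_add_left fmod.span_add fmod.span_zero)

lemma mult_tensor_class:
  assumes "c_algebra sA" "c_algebra sB"
  shows "mult (tensor sA sB) (tensor_class sA sB p) (tensor_class sA sB q) =
    tensor_class sA sB (pre_mult p q)"
proof -
  have "(\<Union>q'\<in>tensor_class sA sB q. tensor_class sA sB (pre_mult p' q')) =
      tensor_class sA sB (pre_mult p' q)" for p'
    by (rule tensor_class_UN) (simp add: pre_mult_span_right assms flip: pre_mult_diff_right)
  moreover have "(\<Union>p'\<in>tensor_class sA sB p. tensor_class sA sB (pre_mult p' q)) =
      tensor_class sA sB (pre_mult p q)"
    by (rule tensor_class_UN [where h = "\<lambda>p'. pre_mult p' q"])
      (simp add: pre_mult_span_left assms flip: pre_mult_diff_left)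
  ultimately show ?thesis by (simp add: tensor_def)
qed

lemma tensor_map_left_class:
  assumes "module_hom sA sA f"
  shows "tensor_map_left sA sB f (tensor_class sA sB p) =
    tensor_class sA sB (\<Sum>(a, b)\<in>keys p. single (f a, b) (lookup p (a, b)))"
proof -
  define h where "h p = (\<Sum>(a, b)\<in>keys p. single (f a, b) (lookup p (a, b)))"
    for p :: "'b \<times> 'c \<Rightarrow>\<^sub>0 'a"
  have add: "h (p + q) = h p + h q" for p q
    using setsum_keys_plus_distrib [of "\<lambda>x v. single (f (fst x), snd x) v" p q]
    by (simp add: h_def split_def single_add)
  have diff: "h (p - q) = h p - h q" for p q
    using add [of "p - q" q] by simp
  have h_single: "h (single (a, b) c) = single (f a, b) c" for a b c
    by (simp add: h_def)
  have h0: "h 0 = 0" by (simp add: h_def)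
  have scale: "h (fscale c p) = fscale c (h p)" for c p
    by (induction p rule: poly_mapping_add_induct)
      (auto simp: h0 add fmod.scale_right_distrib fscale_single h_single)
  have "h p \<in> fmod.span (tensor_relations sA sB)" if "p \<in> fmod.span (tensor_relations sA sB)" for p
    using that
  proof (induction rule: fmod.span_induct_alt)
    case (step d r p)
    note F = module_hom.add [OF assms] module_hom.scale [OF assms]
    from step(1) have "h r \<in> tensor_relations sA sB"
      by (cases rule: tensor_relations_cases)
        (simp_all add: diff h_single scale F tensor_relationsI)
    then show ?case
      using step by (simp add: add scale fmod.span_add fmod.span_scale fmod.span_base)
  qed (simp add: h0 fmod.span_zero)
  then show ?thesis
    unfolding tensor_map_left_def h_def [symmetric]
    by (intro tensor_class_UN) (simp flip: diff)
qed

lemma single_0_mult_eq_fscale: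
  fixes p :: "'k::monoid_add \<Rightarrow>\<^sub>0 'c::comm_ring_1"
  shows "single 0 c * p = fscale c p"
  by (induction p rule: poly_mapping_add_induct)
    (simp_all add: mult_single fscale_single distrib_left fmod.scale_right_distrib)

lemma fscale_mult_left:
  fixes p q :: "'k::monoid_add \<Rightarrow>\<^sub>0 'c::comm_ring_1"
  shows "fscale c p * q = fscale c (p * q)"
  by (simp add: mult.assoc flip: single_0_mult_eq_fscale)

lemma fscale_mult_right:
  fixes p q :: "'k::monoid_add \<Rightarrow>\<^sub>0 'c::comm_ring_1"
  shows "p * fscale c q = fscale c (p * q)"
proof (induction p rule: poly_mapping_add_induct)
  case (single k d)
  show ?case
    by (induction q rule: poly_mapping_add_induct)
      (simp_all add: mult_single fscale_single distrib_left fmod.scale_right_distrib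
        mult.left_commute)
qed (simp_all add: distrib_right fmod.scale_right_distrib)


lemma scale_S_abs: "scale_S c (abs_free_scomm p) = abs_free_scomm (fscale c p)"
  by (simp add: scale_S.abs_eq single_0_mult_eq_fscale)

lemma c_algebra_scale_S: "c_algebra scale_S"
proof
  fix c d :: 'a and x y :: "'a free_scomm"
  obtain p q where xy: "x = abs_free_scomm p" "y = abs_free_scomm q"
    using Quotient_abs_rep [OF Quotient_free_scomm] by metis
  note abs_simps = scale_S_abs plus_free_scomm.abs_eq times_free_scomm.abs_eq
  show "scale_S c (x + y) = scale_S c x + scale_S c y"
    unfolding xy abs_simps by (simp only: fmod.scale_right_distrib)
  show "scale_S (c + d) x = scale_S c x + scale_S d x"
    unfolding xy abs_simps by (simp only: fmod.scale_left_distrib)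
  show "scale_S c (scale_S d x) = scale_S (c * d) x"
    unfolding xy abs_simps by (simp only: fmod.scale_scale)
  show "scale_S 1 x = x"
    unfolding xy abs_simps by (simp only: fmod.scale_one)
  show "scale_S c x * y = scale_S c (x * y)"
    unfolding xy abs_simps by (simp only: fscale_mult_left)
  show "x * scale_S c y = scale_S c (x * y)"
    unfolding xy abs_simps by (simp only: fscale_mult_right)
qed

lemma scale_Sigma_abs:
  "scale_Sigma c (abs_free_sigma p) = abs_free_sigma (fscale (ceps_const c) p)"
  by (simp add: scale_Sigma.abs_eq single_0_mult_eq_fscale)

lemma ceps_const_simps:
  "ceps_const (c + d) = ceps_const c + ceps_const d"
  "ceps_const (c * d) = ceps_const c * ceps_const d"
  "ceps_const 1 = 1"
  by (simp_all add: ceps_const.abs_eq plus_ceps.abs_eq times_ceps.abs_eq one_ceps.abs_eq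
      single_add mult_single)

lemma c_algebra_scale_Sigma: "c_algebra scale_Sigma"
proof
  fix c d :: 'a and x y :: "'a free_sigma"
  obtain p q where xy: "x = abs_free_sigma p" "y = abs_free_sigma q"
    using Quotient_abs_rep [OF Quotient_free_sigma] by metis
  note abs_simps = scale_Sigma_abs plus_free_sigma.abs_eq times_free_sigma.abs_eq ceps_const_simps
  show "scale_Sigma c (x + y) = scale_Sigma c x + scale_Sigma c y"
    unfolding xy abs_simps by (simp only: fmod.scale_right_distrib)
  show "scale_Sigma (c + d) x = scale_Sigma c x + scale_Sigma d x"
    unfolding xy abs_simps by (simp only: fmod.scale_left_distrib)
  show "scale_Sigma c (scale_Sigma d x) = scale_Sigma (c * d) x"
    unfolding xy abs_simps by (simp only: fmod.scale_scale)
  show "scale_Sigma 1 x = x"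
    unfolding xy abs_simps by (simp only: fmod.scale_one)
  show "scale_Sigma c x * y = scale_Sigma c (x * y)"
    unfolding xy abs_simps by (simp only: fscale_mult_left)
  show "x * scale_Sigma c y = scale_Sigma c (x * y)"
    unfolding xy abs_simps by (simp only: fscale_mult_right)
qed

section \<open>Identities with linear function\<close>

text \<open>
  A monomial of the free algebra with linear function is a nonempty word in letters, each letter
  being a variable or the formal function symbol applied to a monomial: \<open>Fn l ls\<close> stands for the
  symbol applied to the word \<open>l # ls\<close>.  Excluding the empty word gives the free algebra without
  unit, as homomorphisms of algebras which need not have a unit require.
\<close>

datatype letter = Var nat | Fn letter "letter list"

definition free_lin_alg :: "('c::comm_ring_1, letter word \<Rightarrow>\<^sub>0 'c) alg" where
  "free_lin_alg = \<lparr>carrier = {p. lookup p 0 = 0}, zero = 0, add = (+), mult = (*), smult = fscale\<rparr>"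

fun fn_word :: "letter word \<Rightarrow> letter word" where
  "fn_word (Word (l # ls)) = Word [Fn l ls]"
| "fn_word (Word []) = Word []"

definition formal_fn :: "(letter word \<Rightarrow>\<^sub>0 'c::comm_ring_1) \<Rightarrow> (letter word \<Rightarrow>\<^sub>0 'c)" where
  "formal_fn p = (\<Sum>w\<in>keys p. single (fn_word w) (lookup p w))"

definition alg_hom :: "('c, 'a) alg \<Rightarrow> ('c, 'b) alg \<Rightarrow> ('a \<Rightarrow> 'b) \<Rightarrow> bool" where
  "alg_hom A B \<phi> \<longleftrightarrow>
     (\<forall>x\<in>carrier A. \<phi> x \<in> carrier B) \<and>
     (\<forall>x\<in>carrier A. \<forall>y\<in>carrier A. \<phi> (add A x y) = add B (\<phi> x) (\<phi> y)) \<and>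
     (\<forall>x\<in>carrier A. \<forall>y\<in>carrier A. \<phi> (mult A x y) = mult B (\<phi> x) (\<phi> y)) \<and>
     (\<forall>c. \<forall>x\<in>carrier A. \<phi> (smult A c x) = smult B c (\<phi> x))"

definition lin_identities ::
    "('c::comm_ring_1, 'b) alg \<Rightarrow> ('b \<Rightarrow> 'b) \<Rightarrow> (letter word \<Rightarrow>\<^sub>0 'c) set" where
  "lin_identities B f = {p \<in> carrier free_lin_alg.
     \<forall>\<phi>. alg_hom free_lin_alg B \<phi> \<and>
          (\<forall>q\<in>carrier free_lin_alg. \<phi> (formal_fn q) = f (\<phi> q)) \<longrightarrow> \<phi> p = zero B}"

end

theory Submission
  imports Defs "HOL-Library.Countable_Set"
begin

text \<open>
  An element of the free algebra with linear function is an identity of \<open>A \<otimes> B\<close> with \<open>tr \<otimes> id\<close> iff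
  it vanishes for all values of the variables, and these values are finite sums of tensors
  \<open>a \<otimes> b\<close>.  Only the algebra \<open>B\<close> changes between the two sides, and identities depend on \<open>B\<close>
  monotonically in two ways (\<open>\<psi>\<close> being a homomorphism of \<open>C\<close>-algebras):

  \<^item> If \<open>\<psi> : B \<rightarrow> D\<close> is surjective, then values in \<open>A \<otimes> D\<close> lift to \<open>A \<otimes> B\<close>, so identities of
    \<open>A \<otimes> B\<close> are identities of \<open>A \<otimes> D\<close> (\<open>lin_identities_surj\<close>).
  \<^item> If \<open>\<psi> : B \<rightarrow> D\<close> has a \<open>C\<close>-linear left inverse, then \<open>A \<otimes> B \<rightarrow> A \<otimes> D\<close> is injective, so
    identities of \<open>A \<otimes> D\<close> are identities of \<open>A \<otimes> B\<close> (\<open>lin_identities_split\<close>).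

  It is enough to find a surjection \<open>S \<rightarrow> \<SS>\<close>, a surjection \<open>\<SS> \<rightarrow> S[\<theta>]\<close> with \<open>\<theta>\<^sup>2 = 2\<close>, and to use
  the inclusion \<open>S \<rightarrow> S[\<theta>]\<close>, which is split by the coefficient of \<open>1\<close>.

  Surjection \<open>S \<rightarrow> \<SS>\<close> (\<open>surjection_S_Sigma\<close>).  As \<open>2\<close> is invertible, \<open>u\<^sub>i = \<theta>\<epsilon>\<^sub>i / 2\<close> is an idempotent of
  \<open>C[\<epsilon>]\<close>, and \<open>\<epsilon>\<^sub>i\<epsilon>\<^sub>j = 2u\<^sub>iu\<^sub>j\<close>.  One thinks of \<open>u\<^sub>i\<close> as an undetermined bit.  The idempotent \<open>q\<^sub>g\<close>
  with \<open>1 - 2q\<^sub>g = \<Prod>\<^bsub>g\<^sub>i = 1\<^esub> (1 - 2u\<^sub>i)\<close> is then the parity of \<open>\<Sum> g\<^sub>iu\<^sub>i\<close>, and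
  \<open>exp(\<epsilon>\<^sub>g\<epsilon>\<^sub>h) = 1 - 2q\<^sub>gq\<^sub>h\<close> is the sign that goes with two such parities.  Hence
  \<open>e\<^sub>g = (1 - q\<^sub>g)e\<^sub>g + q\<^sub>ge\<^sub>g\<close> is the sum of an even and an odd part: the elements \<open>(1 - q\<^sub>g)e\<^sub>g\<close> are
  central and the elements \<open>q\<^sub>ge\<^sub>g\<close> anticommute with each other.  There are countably many elements
  of both kinds, and together with \<open>\<theta>\<close> and the \<open>\<epsilon>\<^sub>i\<close>, which are even, they generate \<open>\<SS>\<close>.

  Surjection \<open>\<SS> \<rightarrow> S[\<theta>]\<close> (\<open>surjection_Sigma_ext\<close>).  Setting all bits \<open>u\<^sub>i\<close> to \<open>1\<close> means sending
  every \<open>\<epsilon>\<^sub>i\<close> to \<open>\<theta>\<close>.  This turns \<open>exp(\<epsilon>\<^sub>g\<epsilon>\<^sub>h)\<close> into \<open>(-1)\<^sup>n\<close>, with \<open>n\<close> the product of the numbers of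
  \<open>1\<close>s in \<open>g\<close> and \<open>h\<close>, so that \<open>e\<^sub>g\<close> may go to an even or odd generator of \<open>S\<close> according to the
  number of \<open>1\<close>s in \<open>g\<close>.
\<close>

section \<open>Linear maps on free modules\<close>

text \<open>
  The linear extension of \<open>g\<close> from the basis \<open>'k\<close> to the free module, with values in any module
  \<open>s\<close> over the coefficient ring.  Taking \<open>s c x = f c * x\<close> for a ring homomorphism \<open>f\<close> gives the maps
  out of monoid rings.
\<close>

definition lin_ext :: "('r::comm_ring_1 \<Rightarrow> 'm \<Rightarrow> 'm::ab_group_add) \<Rightarrow> ('k \<Rightarrow> 'm) \<Rightarrow> ('k \<Rightarrow>\<^sub>0 'r) \<Rightarrow> 'm"
  where "lin_ext s g p = (\<Sum>k\<in>keys p. s (lookup p k) (g k))"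

context module
begin

lemma lin_ext_add: "lin_ext scale g (p + q) = lin_ext scale g p + lin_ext scale g q"
  unfolding lin_ext_def
  by (rule setsum_keys_plus_distrib) (simp_all add: scale_left_distrib)

lemma lin_ext_zero: "lin_ext scale g 0 = 0"
  by (simp add: lin_ext_def)

lemma lin_ext_diff: "lin_ext scale g (p - q) = lin_ext scale g p - lin_ext scale g q"
  using lin_ext_add [of g "p - q" q] by simp

lemma lin_ext_single: "lin_ext scale g (single k c) = scale c (g k)"
  by (simp add: lin_ext_def)

lemma lin_ext_fscale: "lin_ext scale g (fscale c p) = scale c (lin_ext scale g p)"
  by (induction p rule: poly_mapping_add_induct)
    (simp_all add: lin_ext_add lin_ext_zero lin_ext_single fscale_single scale_right_distrib
      fmod.scale_right_distrib)

lemmas lin_ext_simps = lin_ext_add lin_ext_zero lin_ext_diff lin_ext_single lin_ext_fscale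

end

abbreviation reindex :: "('k \<Rightarrow> 'l) \<Rightarrow> ('k \<Rightarrow>\<^sub>0 'c::comm_ring_1) \<Rightarrow> ('l \<Rightarrow>\<^sub>0 'c)" where
  "reindex g \<equiv> lin_ext fscale (\<lambda>k. single (g k) 1)"

lemma reindex_eq_sum: "reindex g p = (\<Sum>k\<in>keys p. single (g k) (lookup p k))"
  by (simp add: lin_ext_def fscale_single)

lemma reindex_comp: "reindex g (reindex h p) = reindex (g \<circ> h) p"
  by (induction p rule: poly_mapping_add_induct) (simp_all add: fmod.lin_ext_simps)

lemma reindex_id: "reindex id p = p"
  by (induction p rule: poly_mapping_add_induct) (simp_all add: fmod.lin_ext_simps fscale_single)

section \<open>Evaluation in the free module on a product\<close>

text \<open>
  An evaluation with values in \<open>tensor sA sB\<close> is lifted to the free module on \<open>'a \<times> 'b\<close> with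
  \<open>pre_mult\<close>, where addition is that of a type and finite sums make sense.  The classes of the
  lifted values are the values in the tensor product.
\<close>

lemma pre_mult_assoc: "pre_mult (pre_mult p q) r = pre_mult p (pre_mult q r)"
proof (induction p rule: poly_mapping_add_induct)
  case (single k c)
  show ?case
  proof (induction q rule: poly_mapping_add_induct)
    case (single l d)
    show ?case
      by (induction r rule: poly_mapping_add_induct; cases k; cases l)
        (auto simp: pre_mult_add_right pre_mult_single mult.assoc)
  qed (simp_all add: pre_mult_add_left pre_mult_add_right)
qed (simp_all add: pre_mult_add_left)

text \<open>
  The value of a letter, for a product \<open>mul\<close>, a function \<open>F\<close> interpreting the formal symbol and
  values \<open>v\<close> of the variables.
\<close>

primrec letter_val ::
    "('b \<Rightarrow> 'b \<Rightarrow> 'b) \<Rightarrow> ('b \<Rightarrow> 'b) \<Rightarrow> (nat \<Rightarrow> 'b) \<Rightarrow> letter \<Rightarrow> 'b" where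
  "letter_val mul F v (Var n) = v n"
| "letter_val mul F v (Fn l ls) = F (foldl mul (letter_val mul F v l) (map (letter_val mul F v) ls))"

fun word_val ::
    "('b::zero \<Rightarrow> 'b \<Rightarrow> 'b) \<Rightarrow> ('b \<Rightarrow> 'b) \<Rightarrow> (nat \<Rightarrow> 'b) \<Rightarrow> letter word \<Rightarrow> 'b" where
  "word_val mul F v (Word []) = 0"
| "word_val mul F v (Word (l # ls)) = foldl mul (letter_val mul F v l) (map (letter_val mul F v) ls)"

lemma foldl_assoc_append:
  assumes "\<And>x y z. mul (mul x y) z = mul x (mul y z)"
  shows "foldl mul x (ys @ z # zs) = mul (foldl mul x ys) (foldl mul z zs)"
  by (induction zs rule: rev_induct) (simp_all add: assms)

lemma word_val_add:
  assumes "\<And>x y z. mul (mul x y) z = mul x (mul y z)" and "w \<noteq> 0" "w' \<noteq> 0"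
  shows "word_val mul F v (w + w') = mul (word_val mul F v w) (word_val mul F v w')"
proof -
  obtain l ls l' ls' where "w = Word (l # ls)" "w' = Word (l' # ls')"
    using assms(2,3) by (metis word.exhaust neq_Nil_conv zero_word_def)
  then show ?thesis
    using foldl_assoc_append [of mul, OF assms(1)] by simp
qed

definition eval ::
    "('a::ring \<Rightarrow> 'a) \<Rightarrow> (nat \<Rightarrow> ('a \<times> 'b::ring \<Rightarrow>\<^sub>0 'c::comm_ring_1)) \<Rightarrow> (letter word \<Rightarrow>\<^sub>0 'c) \<Rightarrow> ('a \<times> 'b \<Rightarrow>\<^sub>0 'c)"
  where "eval f v = lin_ext fscale (word_val pre_mult (reindex (apfst f)) v)"

lemma eval_simps:
  "eval f v 0 = 0"
  "eval f v (p + q) = eval f v p + eval f v q"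
  "eval f v (fscale c p) = fscale c (eval f v p)"
  "eval f v (single w c) = fscale c (word_val pre_mult (reindex (apfst f)) v w)"
  by (simp_all add: eval_def fmod.lin_ext_simps)

text \<open>
  Applying linear induction to \<open>p\<close> minus its constant term keeps the empty word out of the
  induction.
\<close>

lemma constant_free_induct [consumes 1, case_names zero single add]:
  fixes p :: "'x word \<Rightarrow>\<^sub>0 'c::comm_ring_1"
  assumes "lookup p 0 = 0" and "P 0" and "\<And>w c. w \<noteq> 0 \<Longrightarrow> P (single w c)"
    and "\<And>p q. lookup p 0 = 0 \<Longrightarrow> lookup q 0 = 0 \<Longrightarrow> P p \<Longrightarrow> P q \<Longrightarrow> P (p + q)"
  shows "P p"
proof -
  have "P (p - single 0 (lookup p 0))"
  proof (induction p rule: poly_mapping_add_induct)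
    case (single k c)
    then show ?case using assms(2,3) by (cases "k = 0") (simp_all add: lookup_single)
  next
    case (add p q)
    have "p + q - single 0 (lookup (p + q) 0) = (p - single 0 (lookup p 0)) + (q - single 0 (lookup q 0))"
      by (simp add: lookup_add single_add)
    moreover have "P \<dots>"
      using assms(4) add by (simp add: lookup_minus)
    ultimately show ?case by (simp only:)
  qed (simp add: assms(2))
  then show ?thesis by (simp add: assms(1))
qed

lemma eval_mult:
  assumes "lookup p 0 = 0" "lookup q 0 = 0"
  shows "eval f v (p * q) = pre_mult (eval f v p) (eval f v q)"
  using assms(1)
proof (induction p rule: constant_free_induct)
  case (single w c)
  show ?case
    using assms(2)
  proof (induction q rule: constant_free_induct)
    case (single w' c')
    with \<open>w \<noteq> 0\<close> show ?case
      by (simp add: mult_single eval_simps word_val_add pre_mult_assoc pre_mult_fscale_left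
          pre_mult_fscale_right mult.commute)
  qed (simp_all add: eval_simps distrib_left pre_mult_add_right)
qed (simp_all add: eval_simps distrib_right pre_mult_add_left)

lemma formal_fn_reindex: "formal_fn p = reindex fn_word p"
  by (simp add: formal_fn_def reindex_eq_sum)

lemma eval_formal_fn:
  assumes "lookup p 0 = 0"
  shows "eval f v (formal_fn p) = reindex (apfst f) (eval f v p)"
  unfolding formal_fn_reindex using assms
proof (induction p rule: constant_free_induct)
  case (single w c)
  then obtain l ls where "w = Word (l # ls)"
    by (cases w rule: fn_word.cases) (auto simp: zero_word_def)
  then show ?case by (simp add: fmod.lin_ext_simps eval_simps fscale_single)
qed (simp_all add: fmod.lin_ext_simps eval_simps)

lemma tensor_map_left_reindex:
  assumes "module_hom sA sA f"
  shows "tensor_map_left sA sB f (tensor_class sA sB p) = tensor_class sA sB (reindex (apfst f) p)"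
  unfolding tensor_map_left_class [OF assms]
  by (simp add: reindex_eq_sum apfst_def map_prod_def split_def)

lemma tensor_sel:
  "carrier (tensor sA sB) = range (tensor_class sA sB)"
  "zero (tensor sA sB) = tensor_class sA sB 0"
  by (simp_all add: tensor_def)

lemma free_lin_alg_sel:
  "p \<in> carrier free_lin_alg \<longleftrightarrow> lookup p 0 = 0"
  "zero free_lin_alg = 0" "add free_lin_alg = (+)" "mult free_lin_alg = (*)" "smult free_lin_alg = fscale"
  by (simp_all add: free_lin_alg_def)

lemma alg_hom_eval:
  assumes "c_algebra sA" "c_algebra sB"
  shows "alg_hom free_lin_alg (tensor sA sB) (\<lambda>p. tensor_class sA sB (eval f v p))"
  by (simp add: alg_hom_def free_lin_alg_sel tensor_sel eval_simps eval_mult add_tensor_class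
      smult_tensor_class mult_tensor_class assms)

text \<open>
  A homomorphism that respects the linear function is determined by its values on the variables:
  the value of a letter \<open>Fn l ls\<close> is forced by that of the word \<open>l # ls\<close>, whose value is forced by
  those of its letters.
\<close>

lemma lin_hom_eq_eval:
  assumes A: "c_algebra sA" and B: "c_algebra sB" and f: "module_hom sA sA f"
    and hom: "alg_hom free_lin_alg (tensor sA sB) \<phi>"
    and fn: "\<And>q. lookup q 0 = 0 \<Longrightarrow> \<phi> (formal_fn q) = tensor_map_left sA sB f (\<phi> q)"
    and var: "\<And>n. \<phi> (gen (Var n)) = tensor_class sA sB (v n)"
    and p: "lookup p 0 = 0"
  shows "\<phi> p = tensor_class sA sB (eval f v p)"
proof -
  let ?val = "letter_val pre_mult (reindex (apfst f)) v"
  let ?wval = "word_val pre_mult (reindex (apfst f)) v"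
  have hom_add: "\<phi> (p + q) = add (tensor sA sB) (\<phi> p) (\<phi> q)"
    and mult: "\<phi> (p * q) = mult (tensor sA sB) (\<phi> p) (\<phi> q)"
    if "lookup p 0 = 0" "lookup q 0 = 0" for p q
    using hom that by (simp_all add: alg_hom_def free_lin_alg_sel)
  have smult: "\<phi> (fscale c p) = smult (tensor sA sB) c (\<phi> p)" if "lookup p 0 = 0" for p c
    using hom that by (simp add: alg_hom_def free_lin_alg_sel)
  have gen0: "lookup (single (Word (l # ls)) (1::'a)) 0 = 0" for l :: letter and ls
    by (simp add: lookup_single zero_word_def)
  have word: "\<phi> (single (Word (l # ls)) 1) = tensor_class sA sB (?wval (Word (l # ls)))"
    if "\<And>k. k \<in> set (l # ls) \<Longrightarrow> \<phi> (gen k) = tensor_class sA sB (?val k)" for l ls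
    using that
  proof (induction ls rule: rev_induct)
    case (snoc k ls)
    have "single (Word (l # ls @ [k])) (1::'a) = single (Word (l # ls)) 1 * gen k"
      by (simp add: mult_single)
    moreover have "\<phi> (single (Word (l # ls)) 1) = tensor_class sA sB (?wval (Word (l # ls)))"
      using snoc.prems by (intro snoc.IH) auto
    ultimately show ?case
      by (simp add: mult gen0 snoc.prems mult_tensor_class A B)
  qed simp
  have letter: "\<phi> (gen l) = tensor_class sA sB (?val l)" for l
  proof (induction l)
    case (Fn l ls)
    have "gen (Fn l ls) = formal_fn (single (Word (l # ls)) (1::'a))"
      by (simp add: formal_fn_def)
    moreover have "\<phi> (single (Word (l # ls)) 1) = tensor_class sA sB (?wval (Word (l # ls)))"
      using Fn by (intro word) auto
    ultimately show ?case
      by (simp add: fn gen0 tensor_map_left_reindex [OF f])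
  qed (simp add: var)
  show ?thesis
    using p
  proof (induction p rule: constant_free_induct)
    case zero
    \<comment> \<open>\<open>alg_hom\<close> does not speak of zero, but zero is a scalar multiple.\<close>
    have "\<phi> (fscale 0 (gen (Var 0))) = tensor_class sA sB 0"
      using gen0 [of "Var 0" "[]"]
      by (subst smult) (simp_all add: letter smult_tensor_class)
    then show ?case by (simp add: eval_simps)
  next
    case (single w c)
    then obtain l ls where w: "w = Word (l # ls)"
      by (cases w rule: fn_word.cases) (auto simp: zero_word_def)
    have "\<phi> (fscale c (single w 1)) = tensor_class sA sB (fscale c (?wval w))"
      using word [of l ls] by (simp add: w smult gen0 letter smult_tensor_class)
    then show ?case by (simp add: fscale_single eval_simps)
  next
    case (add p q)
    then show ?case by (simp add: hom_add eval_simps add_tensor_class)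
  qed
qed

text \<open>
  The quantifier over homomorphisms becomes one over assignments to the variables, since every
  assignment extends to a homomorphism, and uniquely.
\<close>

lemma lin_identities_tensor_iff:
  assumes A: "c_algebra sA" and B: "c_algebra sB" and f: "module_hom sA sA f"
  shows "p \<in> lin_identities (tensor sA sB) (tensor_map_left sA sB f) \<longleftrightarrow>
    lookup p 0 = 0 \<and> (\<forall>v. eval f v p \<in> fmod.span (tensor_relations sA sB))"
proof (intro iffI conjI allI)
  assume p: "p \<in> lin_identities (tensor sA sB) (tensor_map_left sA sB f)"
  then show p0: "lookup p 0 = 0" by (simp add: lin_identities_def free_lin_alg_sel)
  fix v :: "nat \<Rightarrow> ('b \<times> 'c \<Rightarrow>\<^sub>0 'a)"
  have "tensor_class sA sB (eval f v p) = tensor_class sA sB 0"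
    using p alg_hom_eval [OF A B, of f v]
    by (auto simp: lin_identities_def free_lin_alg_sel tensor_sel eval_formal_fn
        tensor_map_left_reindex [OF f] dest!: spec [of _ "\<lambda>p. tensor_class sA sB (eval f v p)"])
  then show "eval f v p \<in> fmod.span (tensor_relations sA sB)"
    by (simp add: tensor_class_eq_iff)
next
  assume p: "lookup p 0 = 0 \<and> (\<forall>v. eval f v p \<in> fmod.span (tensor_relations sA sB))"
  have "\<phi> p = tensor_class sA sB 0"
    if hom: "alg_hom free_lin_alg (tensor sA sB) \<phi>"
      and fn: "\<forall>q\<in>carrier free_lin_alg. \<phi> (formal_fn q) = tensor_map_left sA sB f (\<phi> q)" for \<phi>
  proof -
    have "\<exists>q. \<phi> (gen (Var n)) = tensor_class sA sB q" for n
    proof -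
      have "gen (Var n) \<in> carrier free_lin_alg"
        by (simp add: free_lin_alg_sel lookup_single zero_word_def)
      with hom have "\<phi> (gen (Var n)) \<in> carrier (tensor sA sB)"
        unfolding alg_hom_def by blast
      then show ?thesis by (auto simp: tensor_sel)
    qed
    then obtain v where "\<And>n. \<phi> (gen (Var n)) = tensor_class sA sB (v n)" by metis
    from lin_hom_eq_eval [OF A B f hom _ this] p fn
    show ?thesis by (simp add: free_lin_alg_sel tensor_class_eq_iff)
  qed
  with p show "p \<in> lin_identities (tensor sA sB) (tensor_map_left sA sB f)"
    by (simp add: lin_identities_def free_lin_alg_sel tensor_sel)
qed

section \<open>Identities and change of the right factor\<close>

abbreviation map_right :: "('b \<Rightarrow> 'd) \<Rightarrow> ('a \<times> 'b \<Rightarrow>\<^sub>0 'c::comm_ring_1) \<Rightarrow> ('a \<times> 'd \<Rightarrow>\<^sub>0 'c)" where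
  "map_right \<psi> \<equiv> reindex (apsnd \<psi>)"

lemma apsnd_comp: "apsnd g \<circ> apsnd h = apsnd (g \<circ> h)"
  by (rule ext) (simp add: apsnd_compose)

text \<open>
  Stated for linear maps, so as to cover the linear left inverse of a homomorphism as well as
  the homomorphism itself.
\<close>

lemma map_right_span:
  assumes "module_hom sB sD \<psi>" and "p \<in> fmod.span (tensor_relations sA sB)"
  shows "map_right \<psi> p \<in> fmod.span (tensor_relations sA sD)"
  using assms(2)
proof (induction rule: fmod.span_induct_alt)
  case (step c r p)
  note F = module_hom.add [OF assms(1)] module_hom.scale [OF assms(1)]
  from step(1) have "map_right \<psi> r \<in> tensor_relations sA sD"
    by (cases rule: tensor_relations_cases)
      (simp_all add: fmod.lin_ext_simps F tensor_relationsI)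
  with step show ?case
    by (simp add: fmod.lin_ext_simps fmod.span_add fmod.span_scale fmod.span_base)
qed (simp add: fmod.lin_ext_simps fmod.span_zero)

lemma map_right_pre_mult:
  assumes "\<And>x y. \<psi> (x * y) = \<psi> x * \<psi> y"
  shows "map_right \<psi> (pre_mult p q) = pre_mult (map_right \<psi> p) (map_right \<psi> q)"
proof (induction p rule: poly_mapping_add_induct)
  case (single k c)
  show ?case
    by (induction q rule: poly_mapping_add_induct; cases k)
      (auto simp: fmod.lin_ext_simps pre_mult_add_right pre_mult_single fscale_single assms)
qed (simp_all add: fmod.lin_ext_simps pre_mult_add_left)

lemma map_right_eval:
  assumes "\<And>x y. \<psi> (x * y) = \<psi> x * \<psi> y"
  shows "map_right \<psi> (eval f v p) = eval f (\<lambda>n. map_right \<psi> (v n)) p"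
proof -
  note mult = map_right_pre_mult [of \<psi>, OF assms]
  have comm: "map_right \<psi> (reindex (apfst f) q) = reindex (apfst f) (map_right \<psi> q)" for q
    by (simp add: reindex_comp comp_def apsnd_apfst_commute)
  have fold: "map_right \<psi> (foldl pre_mult x xs) = foldl pre_mult (map_right \<psi> x) (map (map_right \<psi>) xs)"
    for x xs
    by (induction xs arbitrary: x) (simp_all add: mult)
  have letter: "map_right \<psi> (letter_val pre_mult (reindex (apfst f)) v l) =
      letter_val pre_mult (reindex (apfst f)) (\<lambda>n. map_right \<psi> (v n)) l" for l
    by (induction l) (simp_all add: comm fold comp_def cong: map_cong)
  have word: "map_right \<psi> (word_val pre_mult (reindex (apfst f)) v w) =
      word_val pre_mult (reindex (apfst f)) (\<lambda>n. map_right \<psi> (v n)) w" for w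
    by (cases w rule: fn_word.cases) (simp_all add: fold letter comp_def fmod.lin_ext_zero)
  show ?thesis
    by (induction p rule: poly_mapping_add_induct) (simp_all add: eval_simps fmod.lin_ext_simps word)
qed

text \<open>
  A set-theoretic section of \<open>\<psi>\<close> lifts the assignment already in the free module on pairs, where it
  is just a change of basis elements.
\<close>

lemma lin_identities_surj:
  assumes "c_algebra sA" "c_algebra sB" "c_algebra sD" "module_hom sA sA f"
    and lin: "module_hom sB sD \<psi>" and mult: "\<And>x y. \<psi> (x * y) = \<psi> x * \<psi> y" and "surj \<psi>"
  shows "lin_identities (tensor sA sB) (tensor_map_left sA sB f) \<subseteq>
    lin_identities (tensor sA sD) (tensor_map_left sA sD f)"
proof
  fix p assume p: "p \<in> lin_identities (tensor sA sB) (tensor_map_left sA sB f)"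
  have "eval f v p \<in> fmod.span (tensor_relations sA sD)" for v
  proof -
    let ?v = "\<lambda>n. map_right (inv \<psi>) (v n)"
    have "map_right \<psi> (?v n) = v n" for n
      using reindex_id [of "v n"]
      by (simp add: reindex_comp apsnd_comp surj_iff [THEN iffD1, OF \<open>surj \<psi>\<close>])
    then have "eval f v p = map_right \<psi> (eval f ?v p)"
      by (simp add: map_right_eval mult)
    then show ?thesis
      using p assms by (simp add: lin_identities_tensor_iff map_right_span [OF lin])
  qed
  then show "p \<in> lin_identities (tensor sA sD) (tensor_map_left sA sD f)"
    using p assms by (simp add: lin_identities_tensor_iff)
qed

text \<open>
  Applying \<open>\<rho>\<close> after \<open>\<psi>\<close> gives back the value of the polynomial, so it is a tensor relation as soon
  as its image under \<open>\<psi>\<close> is.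
\<close>

lemma lin_identities_split:
  assumes "c_algebra sA" "c_algebra sB" "c_algebra sD" "module_hom sA sA f"
    and mult: "\<And>x y. \<psi> (x * y) = \<psi> x * \<psi> y"
    and lin: "module_hom sD sB \<rho>" and inverse: "\<And>x. \<rho> (\<psi> x) = x"
  shows "lin_identities (tensor sA sD) (tensor_map_left sA sD f) \<subseteq>
    lin_identities (tensor sA sB) (tensor_map_left sA sB f)"
proof
  fix p assume p: "p \<in> lin_identities (tensor sA sD) (tensor_map_left sA sD f)"
  have "\<rho> \<circ> \<psi> = id" using inverse by auto
  have "eval f v p \<in> fmod.span (tensor_relations sA sB)" for v
  proof -
    have "eval f v p = map_right \<rho> (map_right \<psi> (eval f v p))"
      using reindex_id [of "eval f v p"]
      by (simp add: reindex_comp apsnd_comp \<open>\<rho> \<circ> \<psi> = id\<close>)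
    moreover have "map_right \<psi> (eval f v p) \<in> fmod.span (tensor_relations sA sD)"
      using p assms by (simp add: lin_identities_tensor_iff map_right_eval [of \<psi>, OF mult])
    ultimately show ?thesis
      using map_right_span [OF lin] by metis
  qed
  then show "p \<in> lin_identities (tensor sA sB) (tensor_map_left sA sB f)"
    using p assms by (simp add: lin_identities_tensor_iff)
qed

section \<open>Homomorphisms out of monoid rings\<close>

locale central_hom =
  fixes f :: "'r::comm_ring_1 \<Rightarrow> 't::ring_1"
  assumes add: "f (c + d) = f c + f d" and mult: "f (c * d) = f c * f d" and one: "f 1 = 1"
    and central: "f c * x = x * f c"
begin

sublocale module "\<lambda>c x. f c * x"
  by unfold_locales (simp_all add: add mult one algebra_simps)

abbreviation hom_ext :: "('k \<Rightarrow> 't) \<Rightarrow> ('k \<Rightarrow>\<^sub>0 'r) \<Rightarrow> 't" where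
  "hom_ext \<equiv> lin_ext (\<lambda>c x. f c * x)"

lemma zero: "f 0 = 0" and diff: "f (c - d) = f c - f d"
proof -
  show "f 0 = 0" using add [of 0 0] by simp
  show "f (c - d) = f c - f d" using add [of "c - d" d] by simp
qed

lemma hom_ext_mult:
  fixes \<mu> :: "'k::monoid_add \<Rightarrow> 't"
  assumes "\<And>k l. \<mu> (k + l) = \<mu> k * \<mu> l"
  shows "hom_ext \<mu> (p * q) = hom_ext \<mu> p * hom_ext \<mu> q"
proof (induction p rule: poly_mapping_add_induct)
  case (single k c)
  show ?case
  proof (induction q rule: poly_mapping_add_induct)
    case (single l d)
    have "f (c * d) * \<mu> (k + l) = f c * (f d * \<mu> k) * \<mu> l"
      by (simp only: mult assms mult.assoc)
    also have "\<dots> = f c * \<mu> k * (f d * \<mu> l)"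
      by (simp only: central [of d "\<mu> k"] mult.assoc)
    finally show ?case by (simp only: mult_single lin_ext_single)
  qed (simp_all add: lin_ext_simps distrib_left)
qed (simp_all add: lin_ext_simps distrib_right)

lemma hom_ext_scalar:
  assumes "\<mu> 0 = 1"
  shows "hom_ext \<mu> (single 0 c) = f c"
  by (simp add: lin_ext_single assms)

lemma hom_ext_one:
  assumes "\<mu> 0 = 1"
  shows "hom_ext \<mu> 1 = 1"
  using hom_ext_scalar [of \<mu> 1] assms by (simp add: one)

end

fun word_prod :: "('x \<Rightarrow> 't::ring_1) \<Rightarrow> 'x word \<Rightarrow> 't" where
  "word_prod G (Word xs) = prod_list (map G xs)"

lemma word_prod_0: "word_prod G 0 = 1"
  by (simp add: zero_word_def)

lemma word_prod_add: "word_prod G (v + w) = word_prod G v * word_prod G w"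
  by (cases v; cases w) simp

lemma hom_ideal_cong:
  fixes \<phi> :: "'r::ring_1 \<Rightarrow> 't::ring_1"
  assumes add: "\<And>x y. \<phi> (x + y) = \<phi> x + \<phi> y" and mult: "\<And>x y. \<phi> (x * y) = \<phi> x * \<phi> y"
    and rel: "\<And>g. g \<in> G \<Longrightarrow> \<phi> g = 0" and "ideal_cong G x y"
  shows "\<phi> x = \<phi> y"
proof -
  have zero: "\<phi> 0 = 0" using add [of 0 0] by simp
  have "\<phi> z = 0" if "z \<in> ideal_gen G" for z
    using that by induction (simp_all add: zero add mult rel)
  then have "\<phi> (x - y) = 0" using assms(4) by (simp add: ideal_cong_def)
  then show ?thesis using add [of "x - y" y] by simp
qed

text \<open>
  Scalars and generators generate the free algebra as a ring.  This serves to show that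
  homomorphisms are surjective.
\<close>

lemma word_alg_induct [case_names scalar gen add mult]:
  fixes p :: "'x word \<Rightarrow>\<^sub>0 'c::comm_ring_1"
  assumes "\<And>c. P (single 0 c)" and "\<And>x. P (gen x)"
    and "\<And>p q. P p \<Longrightarrow> P q \<Longrightarrow> P (p + q)" and "\<And>p q. P p \<Longrightarrow> P q \<Longrightarrow> P (p * q)"
  shows "P p"
proof (induction p rule: poly_mapping_add_induct)
  case (single w c)
  have "P (single (Word xs) 1)" for xs
  proof (induction xs)
    case Nil
    show ?case using assms(1) [of 1] by (simp add: zero_word_def)
  next
    case (Cons x xs)
    have "single (Word (x # xs)) 1 = gen x * single (Word xs) (1::'c)"
      by (simp add: mult_single)
    with assms(4) [OF assms(2) Cons.IH] show ?case by simp
  qed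
  from assms(4) [OF assms(1) [of c] this] show ?case
    by (cases w) (simp add: mult_single)
next
  case zero
  show ?case using assms(1) [of 0] by simp
qed (rule assms(3))

lemma poly_induct [case_names scalar gen add mult]:
  fixes p :: "('x \<Rightarrow>\<^sub>0 nat) \<Rightarrow>\<^sub>0 'c::comm_ring_1"
  assumes "\<And>c. P (single 0 c)" and "\<And>x. P (single (single x 1) 1)"
    and "\<And>p q. P p \<Longrightarrow> P q \<Longrightarrow> P (p + q)" and "\<And>p q. P p \<Longrightarrow> P q \<Longrightarrow> P (p * q)"
  shows "P p"
proof (induction p rule: poly_mapping_add_induct)
  case (single m c)
  have one: "P 1" using assms(1) [of 1] by simp
  have power: "P (single (single x n) 1)" for x n
  proof (induction n)
    case (Suc n)
    have "single (single x (Suc n)) 1 = single (single x 1) 1 * single (single x n) (1::'c)"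
      by (simp add: mult_single flip: single_add)
    then show ?case using assms(4) [OF assms(2) Suc] by metis
  qed (simp add: one)
  have "P (single m 1)"
  proof (induction m rule: Poly_Mapping.update_induct)
    case (update m x n)
    have "Poly_Mapping.update x n m = single x n + m"
      using update(1)
      by (intro poly_mapping_eqI) (auto simp: lookup_update lookup_add lookup_single in_keys_iff when_def)
    then show ?case using assms(4) [OF power update(3)] by (simp add: mult_single)
  qed (simp add: one)
  from assms(4) [OF assms(1) [of c] this] show ?case by (simp add: mult_single)
next
  case zero
  show ?case using assms(1) [of 0] by simp
qed (rule assms(3))

section \<open>Homomorphisms out of the free supercommutative algebra\<close>

lemma abs_free_scomm_eq_iff: "abs_free_scomm p = abs_free_scomm q \<longleftrightarrow> ideal_cong supercommutators p q"
  using Quotient_rel [OF Quotient_free_scomm] by (auto simp: ideal_cong_refl)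

lemma free_scomm_cases: obtains p where "x = abs_free_scomm p"
  using Quotient_abs_rep [OF Quotient_free_scomm] by metis

lemma rep_abs_free_scomm: "ideal_cong supercommutators (rep_free_scomm (abs_free_scomm p)) p"
  by (rule Quotient_rep_abs [OF Quotient_free_scomm ideal_cong_refl])

text \<open>
  The degrees \<open>i\<close> and \<open>j\<close> are parameters, because the target rings of the homomorphisms below
  carry no grading.
\<close>

definition supercommute :: "nat \<Rightarrow> nat \<Rightarrow> 't::ring_1 \<Rightarrow> 't \<Rightarrow> bool" where
  "supercommute i j x y \<longleftrightarrow> x * y = (-1) ^ (i * j) * (y * x)"

lemma supercommute_sym: "supercommute i j x y \<Longrightarrow> supercommute j i y x"
  by (cases "even (i * j)") (auto simp: supercommute_def mult.commute [of j])

lemma supercommute_mult: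
  assumes "supercommute i j x y" "supercommute i k x z"
  shows "supercommute i (j + k) x (y * z)"
proof -
  have "x * (y * z) = (-1) ^ (i * j) * (y * (x * z))"
    using assms(1) by (simp add: supercommute_def flip: mult.assoc)
  also have "\<dots> = (-1) ^ (i * j) * (y * ((-1) ^ (i * k) * (z * x)))"
    using assms(2) by (simp add: supercommute_def)
  also have "\<dots> = (-1) ^ (i * (j + k)) * (y * z * x)"
    by (cases "even (i * k)") (simp_all add: distrib_left power_add mult.assoc)
  finally show ?thesis by (simp add: supercommute_def)
qed

lemma supercommute_sum:
  "(\<And>v. v \<in> V \<Longrightarrow> supercommute i j x (g v)) \<Longrightarrow> supercommute i j x (\<Sum>v\<in>V. g v)"
  by (simp add: supercommute_def sum_distrib_left sum_distrib_right)

lemma odd_count_Cons: "odd_count (Word (a # xs)) = odd_count (Word [a]) + odd_count (Word xs)"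
  by simp

lemma supercommute_generators:
  fixes a b :: sgen
  shows "supercommute (odd_count (Word [a])) (odd_count (Word [b]))
    (abs_free_scomm (gen a)) (abs_free_scomm (gen b) :: 'c::comm_ring_1 free_scomm)"
proof -
  define d where "d x = odd_count (Word [x])" for x
  have "homogeneous (d x) (gen x)" for x
    by (simp add: homogeneous_def d_def)
  then have "gen a * gen b - (-1) ^ (d a * d b) * (gen b * gen a) \<in>
      (supercommutators :: (sgen word \<Rightarrow>\<^sub>0 'c) set)"
    unfolding supercommutators_def by blast
  then have "abs_free_scomm (gen a * gen b) =
      (abs_free_scomm ((-1) ^ (d a * d b) * (gen b * gen a)) :: 'c free_scomm)"
    by (simp only: abs_free_scomm_eq_iff ideal_cong_def ideal_gen.gen)
  moreover have "abs_free_scomm 1 = (1 :: 'c free_scomm)"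
    by (simp add: one_free_scomm.abs_eq)
  then have "abs_free_scomm ((-1) ^ n) = ((-1) ^ n :: 'c free_scomm)" for n
    by (cases "even n") (simp_all add: uminus_free_scomm.abs_eq [symmetric])
  ultimately show ?thesis by (simp add: supercommute_def d_def times_free_scomm.abs_eq [symmetric])
qed

text \<open>
  Degrees add up along products, so the relation passes from generators to words in each argument
  in turn.
\<close>

lemma word_prod_supercommute:
  fixes G :: "sgen \<Rightarrow> 't::ring_1"
  assumes gen: "\<And>a b. supercommute (odd_count (Word [a])) (odd_count (Word [b])) (G a) (G b)"
  shows "supercommute (odd_count v) (odd_count w) (word_prod G v) (word_prod G w)"
proof -
  have letter: "supercommute (odd_count (Word [a])) (odd_count (Word ys)) (G a) (word_prod G (Word ys))"
    for a ys
  proof (induction ys)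
    case (Cons b ys)
    with supercommute_mult [OF gen [of a b]] show ?case
      by (simp add: odd_count_Cons [of b ys] del: odd_count.simps)
  qed (simp add: supercommute_def)
  have "supercommute (odd_count (Word ys)) (odd_count (Word xs)) (word_prod G (Word ys)) (word_prod G (Word xs))"
    for xs ys
  proof (induction xs)
    case (Cons a xs)
    with supercommute_mult [OF supercommute_sym [OF letter [of a ys]]] show ?case
      by (simp add: odd_count_Cons [of a xs] del: odd_count.simps)
  qed (simp add: supercommute_def)
  then show ?thesis by (cases v; cases w) (simp only:)
qed

context central_hom
begin

lemma supercommute_scale: "supercommute i j x y \<Longrightarrow> supercommute i j x (f c * y)"
proof -
  have "x * (f c * y) = f c * (x * y)" "f c * y * x = f c * (y * x)"
    by (simp_all add: central [of c x] flip: mult.assoc)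
  then show "supercommute i j x y \<Longrightarrow> supercommute i j x (f c * y)"
    by (cases "even (i * j)") (simp_all only: supercommute_def, simp_all)
qed

text \<open>
  The relations of \<open>S\<close> are about all homogeneous elements, but supercommutators are bilinear, so
  it is enough to check words, hence generators.
\<close>

lemma hom_ext_supercommutator:
  fixes G :: "sgen \<Rightarrow> 't"
  assumes gen: "\<And>a b. supercommute (odd_count (Word [a])) (odd_count (Word [b])) (G a) (G b)"
    and "s \<in> supercommutators"
  shows "hom_ext (word_prod G) s = 0"
proof -
  let ?h = "hom_ext (word_prod G)"
  note hmult = hom_ext_mult [of "word_prod G", OF word_prod_add]
  obtain a b i j where s: "s = a * b - (-1) ^ (i * j) * (b * a)"
    and a: "homogeneous i a" and b: "homogeneous j b"
    using assms(2) by (auto simp: supercommutators_def)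
  have word: "supercommute i j (word_prod G v) (word_prod G w)"
    if "v \<in> keys a" "w \<in> keys b" for v w
  proof -
    have "even (odd_count v) = even i" "even (odd_count w) = even j"
      using a b that by (auto simp: homogeneous_def even_iff_mod_2_eq_zero)
    then show ?thesis
      using word_prod_supercommute [of G, OF gen, of v w] by (auto simp: supercommute_def minus_one_power_iff)
  qed
  have "supercommute j i (?h b) (word_prod G v)" if "v \<in> keys a" for v
    by (rule supercommute_sym, unfold lin_ext_def)
      (intro supercommute_sum supercommute_scale word that)
  then have "supercommute j i (?h b) (?h a)"
    unfolding lin_ext_def [of _ _ a] by (intro supercommute_sum supercommute_scale)
  then have "supercommute i j (?h a) (?h b)" by (rule supercommute_sym)
  then show ?thesis
    by (cases "even (i * j)") (simp_all add: supercommute_def s lin_ext_simps hmult)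
qed

lemma free_scomm_lift:
  assumes gen: "\<And>a b. supercommute (odd_count (Word [a])) (odd_count (Word [b])) (G a) (G b)"
  obtains \<phi> :: "'r free_scomm \<Rightarrow> 't" where
    "\<And>x y. \<phi> (x + y) = \<phi> x + \<phi> y" "\<And>x y. \<phi> (x * y) = \<phi> x * \<phi> y"
    "\<And>c x. \<phi> (scale_S c x) = f c * \<phi> x" "\<phi> 1 = 1" "\<And>a. \<phi> (abs_free_scomm (gen a)) = G a"
proof
  let ?h = "hom_ext (word_prod G)"
  define \<phi> where "\<phi> x = ?h (rep_free_scomm x)" for x
  have hmult: "?h (p * q) = ?h p * ?h q" for p q
    by (rule hom_ext_mult) (rule word_prod_add)
  have abs: "\<phi> (abs_free_scomm p) = ?h p" for p
    unfolding \<phi>_def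
    by (rule hom_ideal_cong [OF lin_ext_add hmult _ rep_abs_free_scomm])
      (rule hom_ext_supercommutator [OF gen])
  show "\<phi> (x + y) = \<phi> x + \<phi> y" for x y
    by (cases x rule: free_scomm_cases; cases y rule: free_scomm_cases)
      (simp add: plus_free_scomm.abs_eq abs lin_ext_add)
  show "\<phi> (x * y) = \<phi> x * \<phi> y" for x y
    by (cases x rule: free_scomm_cases; cases y rule: free_scomm_cases)
      (simp add: times_free_scomm.abs_eq abs hmult)
  show "\<phi> (scale_S c x) = f c * \<phi> x" for c x
    by (cases x rule: free_scomm_cases) (simp add: scale_S_abs abs lin_ext_fscale)
  show "\<phi> 1 = 1"
    by (simp add: one_free_scomm.abs_eq abs hom_ext_one word_prod_0)
  show "\<phi> (abs_free_scomm (gen a)) = G a" for a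
    by (simp add: abs lin_ext_single one)
qed

end

section \<open>The ring \<open>C[\<epsilon>]\<close>\<close>

lift_definition theta :: "'c::comm_ring_1 ceps" is poly_theta .

lemma abs_ceps_eq_iff: "abs_ceps p = abs_ceps q \<longleftrightarrow> ideal_cong ceps_relations p q"
  using Quotient_rel [OF Quotient_ceps] by (auto simp: ideal_cong_refl)

lemma ceps_cases: obtains p where "x = abs_ceps p"
  using Quotient_abs_rep [OF Quotient_ceps] by metis

lemma rep_abs_ceps: "ideal_cong ceps_relations (rep_ceps (abs_ceps p)) p"
  by (rule Quotient_rep_abs [OF Quotient_ceps ideal_cong_refl])

lemma theta_square: "theta * theta = (2 :: 'c::comm_ring_1 ceps)"
proof -
  have "poly_theta\<^sup>2 - 2 \<in> (ceps_relations :: ((epsgen \<Rightarrow>\<^sub>0 nat) \<Rightarrow>\<^sub>0 'c) set)"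
    by (simp add: ceps_relations_def)
  then have "abs_ceps (poly_theta * poly_theta) = (abs_ceps 2 :: 'c ceps)"
    by (simp only: abs_ceps_eq_iff ideal_cong_def ideal_gen.gen power2_eq_square)
  also have "\<dots> = 1 + 1"
    by (simp only: one_ceps.abs_eq plus_ceps.abs_eq one_add_one)
  finally show ?thesis
    by (simp add: theta.abs_eq times_ceps.abs_eq)
qed

lemma eps_square: "eps i * eps i = theta * (eps i :: 'c::comm_ring_1 ceps)"
proof -
  have "(poly_eps i)\<^sup>2 - poly_theta * poly_eps i \<in> (ceps_relations :: ((epsgen \<Rightarrow>\<^sub>0 nat) \<Rightarrow>\<^sub>0 'c) set)"
    unfolding ceps_relations_def by blast
  then have "abs_ceps (poly_eps i * poly_eps i) = (abs_ceps (poly_theta * poly_eps i) :: 'c ceps)"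
    by (simp only: abs_ceps_eq_iff ideal_cong_def ideal_gen.gen power2_eq_square)
  then show ?thesis
    by (simp add: theta.abs_eq eps.abs_eq times_ceps.abs_eq)
qed

definition support :: "(nat \<Rightarrow>\<^sub>0 bit) \<Rightarrow> nat set" where
  "support g = {i. lookup g i = 1}"

text \<open>
  With \<open>half\<close> the inverse of \<open>2\<close>, and \<open>u\<^sub>i = \<theta>\<epsilon>\<^sub>i / 2\<close>, this is the idempotent \<open>q\<close> for which
  \<open>1 - 2q\<close> is the product of the signs \<open>1 - 2u\<^sub>i\<close> over the support of \<open>g\<close>: the sum of the bits \<open>u\<^sub>i\<close>
  modulo 2.
\<close>

definition parity_idem :: "'c ceps \<Rightarrow> (nat \<Rightarrow>\<^sub>0 bit) \<Rightarrow> 'c::comm_ring_1 ceps" where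
  "parity_idem half g = half * (1 - (\<Prod>i\<in>support g. 1 - theta * eps i))"

text \<open>
  Where \<open>z\<close> is \<open>1\<close> both sides are the product of the \<open>1 - u j\<close>; where \<open>z\<close> is \<open>0\<close> both are \<open>1\<close>.
\<close>

lemma prod_one_minus_idem:
  fixes z :: "'r::comm_ring_1"
  assumes z: "z * z = z"
  shows "(\<Prod>j\<in>J. 1 - z * u j) = 1 - z * (1 - (\<Prod>j\<in>J. 1 - u j))"
proof (induction J rule: infinite_finite_induct)
  case (insert j J)
  let ?P = "\<Prod>j\<in>J. 1 - u j"
  have "(1 - z * u j) * (1 - z * (1 - ?P)) =
      1 - z * (1 - (1 - u j) * ?P) + (z * z - z) * u j * (1 - ?P)"
    by (simp add: algebra_simps)
  also have "\<dots> = 1 - z * (1 - (1 - u j) * ?P)"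
    by (simp only: z) simp
  finally show ?case using insert by simp
qed simp_all

context
  fixes half :: "'c::comm_ring_1 ceps"
  assumes half: "2 * half = 1"
begin

private lemma cancel_half: "half * (half * (2 * x)) = half * x" "half * (2 * x) = x"
proof -
  show "half * (2 * x) = x" for x
  proof -
    have "half * (2 * x) = 2 * half * x" by (simp only: ac_simps)
    then show ?thesis by (simp add: half)
  qed
  then show "half * (half * (2 * x)) = half * x" by simp
qed

lemma theta_eps_square: "(theta * eps i) * (theta * eps i) = 2 * (theta * eps i :: 'c ceps)"
proof -
  have "(theta * eps i) * (theta * eps i) = theta * theta * (eps i * (eps i :: 'c ceps))"
    by (simp only: ac_simps)
  then show ?thesis by (simp only: theta_square eps_square)
qed

lemma parity_idem_idem: "parity_idem half g * parity_idem half g = parity_idem half g"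
proof -
  let ?P = "\<Prod>i\<in>support g. 1 - theta * (eps i :: 'c ceps)"
  have square: "(1 - a) * (1 - a) = 1 - 2 * a + a * a" for a :: "'c ceps"
    by (simp add: algebra_simps)
  have "?P * ?P = (\<Prod>i\<in>support g. (1 - theta * eps i) * (1 - theta * (eps i :: 'c ceps)))"
    by (rule prod.distrib [symmetric])
  also have "\<dots> = 1"
    by (simp only: square theta_eps_square) simp
  finally have "(1 - ?P) * (1 - ?P) = 2 * (1 - ?P)"
    by (simp only: square) simp
  then have "half * (half * ((1 - ?P) * (1 - ?P))) = half * (1 - ?P)"
    by (simp only: cancel_half)
  then show ?thesis
    by (simp only: parity_idem_def ac_simps)
qed

text \<open>
  The factors of \<open>exp_eps g h\<close> are \<open>1 - 2u\<^sub>iu\<^sub>j\<close>.  The product over \<open>j\<close> is collected by means of the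
  idempotent \<open>u\<^sub>i\<close>, and then the product over \<open>i\<close> by means of the idempotent of \<open>h\<close>.
\<close>

lemma exp_eps_parity_idem: "exp_eps g h = 1 - 2 * parity_idem half g * parity_idem half h"
proof -
  let ?u = "\<lambda>i. half * (theta * eps i) :: 'c ceps"
  let ?q = "parity_idem half :: _ \<Rightarrow> 'c ceps"
  have u: "?u i * ?u i = ?u i" for i
  proof -
    have "?u i * ?u i = half * (half * ((theta * eps i) * (theta * eps i)))"
      by (simp only: ac_simps)
    then show ?thesis by (simp only: theta_eps_square cancel_half)
  qed
  have "?u i * (theta * eps j) = half * (theta * theta * (eps i * eps j))" for i j
    by (simp only: ac_simps)
  then have eps: "eps i * eps j = ?u i * (theta * eps j)" for i j
    by (simp only: theta_square cancel_half)
  have complement: "2 * ?q g = 1 - (\<Prod>i\<in>support g. 1 - theta * eps i)" for g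
    using half by (simp add: parity_idem_def flip: mult.assoc)
  have "exp_eps g h = (\<Prod>i\<in>support g. \<Prod>j\<in>support h. 1 - ?u i * (theta * eps j))"
    by (simp add: exp_eps_def support_def flip: eps)
  also have "\<dots> = (\<Prod>i\<in>support g. 1 - ?u i * (2 * ?q h))"
    by (simp only: prod_one_minus_idem [OF u] complement)
  also have "\<dots> = (\<Prod>i\<in>support g. 1 - ?q h * (theta * eps i))"
  proof (intro prod.cong refl)
    fix i
    have "?u i * (2 * ?q h) = half * (2 * (theta * eps i * ?q h))"
      by (simp only: ac_simps)
    then show "1 - ?u i * (2 * ?q h) = 1 - ?q h * (theta * eps i)"
      by (simp only: cancel_half mult.commute [of "theta * eps i"])
  qed
  also have "\<dots> = 1 - 2 * ?q g * ?q h"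
    by (simp only: prod_one_minus_idem [OF parity_idem_idem] flip: complement) (simp only: ac_simps)
  finally show ?thesis .
qed

end

section \<open>The algebra \<open>\<SS>\<close>\<close>

definition sigma_const :: "'c ceps \<Rightarrow> 'c::comm_ring_1 free_sigma" where
  "sigma_const c = abs_free_sigma (single 0 c)"

definition sigma_E :: "(nat \<Rightarrow>\<^sub>0 bit) \<Rightarrow> nat \<Rightarrow> 'c::comm_ring_1 free_sigma" where
  "sigma_E g n = abs_free_sigma (gen (E g n))"

lemma abs_free_sigma_eq_iff: "abs_free_sigma p = abs_free_sigma q \<longleftrightarrow> ideal_cong sigma_relations p q"
  using Quotient_rel [OF Quotient_free_sigma] by (auto simp: ideal_cong_refl)

lemma free_sigma_cases: obtains p where "x = abs_free_sigma p"
  using Quotient_abs_rep [OF Quotient_free_sigma] by metis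

lemma rep_abs_free_sigma: "ideal_cong sigma_relations (rep_free_sigma (abs_free_sigma p)) p"
  by (rule Quotient_rep_abs [OF Quotient_free_sigma ideal_cong_refl])

lemma sigma_const_mult: "sigma_const c * abs_free_sigma p = abs_free_sigma (fscale c p)"
  by (simp add: sigma_const_def times_free_sigma.abs_eq single_0_mult_eq_fscale)

lemma central_hom_sigma_const: "central_hom sigma_const"
proof
  fix c d :: "'a ceps" and x :: "'a free_sigma"
  show "sigma_const (c + d) = sigma_const c + sigma_const d"
    by (simp add: sigma_const_def plus_free_sigma.abs_eq single_add)
  show "sigma_const (c * d) = sigma_const c * sigma_const d"
    by (simp add: sigma_const_def times_free_sigma.abs_eq mult_single)
  show "sigma_const 1 = (1 :: 'a free_sigma)"
    by (simp add: sigma_const_def one_free_sigma.abs_eq)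
  obtain p where x: "x = abs_free_sigma p" by (rule free_sigma_cases)
  have "fscale c 1 = (single 0 c :: sigma_gen word \<Rightarrow>\<^sub>0 'a ceps)"
    by (simp only: fscale_single mult_1_right flip: single_one)
  then have "p * single 0 c = fscale c p"
    using fscale_mult_right [of p c 1] by simp
  then show "sigma_const c * x = x * sigma_const c"
    unfolding x by (simp add: sigma_const_mult) (simp add: sigma_const_def times_free_sigma.abs_eq)
qed

interpretation sigma_const: central_hom sigma_const
  by (rule central_hom_sigma_const)

lemma scale_Sigma_eq: "scale_Sigma c x = sigma_const (ceps_const c) * x"
  by (cases x rule: free_sigma_cases) (simp add: scale_Sigma_abs sigma_const_mult)

lemma sigma_E_commute:
  "sigma_E h m * sigma_E g n = sigma_const (exp_eps g h) * (sigma_E g n * (sigma_E h m :: 'c::comm_ring_1 free_sigma))"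
proof -
  let ?x = "gen (E g n) :: sigma_gen word \<Rightarrow>\<^sub>0 'c ceps" and ?y = "gen (E h m) :: sigma_gen word \<Rightarrow>\<^sub>0 'c ceps"
  have "?x * ?y - ?y * ?x - single 0 (1 - exp_eps g h) * (?x * ?y) \<in> sigma_relations"
    unfolding sigma_relations_def by blast
  then have "abs_free_sigma (?x * ?y - ?y * ?x) = abs_free_sigma (single 0 (1 - exp_eps g h) * (?x * ?y))"
    by (simp add: abs_free_sigma_eq_iff ideal_cong_def ideal_gen.gen)
  then have "sigma_E g n * sigma_E h m - sigma_E h m * sigma_E g n =
      sigma_const (1 - exp_eps g h) * (sigma_E g n * (sigma_E h m :: 'c free_sigma))"
    by (simp only: sigma_E_def sigma_const_def times_free_sigma.abs_eq minus_free_sigma.abs_eq)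
  then show ?thesis
    by (simp add: sigma_const.diff sigma_const.one algebra_simps)
qed

lemma supercommute_weighted_E:
  assumes "(-1) ^ (i * j) * (x * y * exp_eps g h) = x * y"
  shows "supercommute i j (sigma_const x * sigma_E g n) (sigma_const y * sigma_E h m)"
proof -
  have regroup: "(sigma_const a * u) * (sigma_const b * v) = sigma_const (a * b) * (u * v)"
    for a b and u v :: "'a free_sigma"
  proof -
    have "u * (sigma_const b * v) = sigma_const b * (u * v)"
      by (metis mult.assoc sigma_const.central)
    then show ?thesis by (simp only: sigma_const.mult mult.assoc)
  qed
  have neg: "sigma_const (- a) = - sigma_const a" for a :: "'a ceps"
    using sigma_const.diff [of 0 a] by (simp add: sigma_const.zero)
  have "sigma_const y * sigma_E h m * (sigma_const x * sigma_E g n) =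
      sigma_const (x * y * exp_eps g h) * (sigma_E g n * sigma_E h m)"
    by (subst regroup, subst sigma_E_commute) (simp only: mult.commute [of y x] sigma_const.mult mult.assoc)
  moreover have "sigma_const x * sigma_E g n * (sigma_const y * sigma_E h m) =
      sigma_const ((-1) ^ (i * j) * (x * y * exp_eps g h)) * (sigma_E g n * sigma_E h m)"
    by (simp only: regroup assms)
  ultimately show ?thesis
    by (cases "even (i * j)") (simp_all add: supercommute_def neg)
qed

lemma ceps_generated [case_names const theta eps add mult]:
  fixes x :: "'c::comm_ring_1 ceps"
  assumes "\<And>c. P (ceps_const c)" "P theta" "\<And>i. P (eps i)"
    and "\<And>x y. P x \<Longrightarrow> P y \<Longrightarrow> P (x + y)" "\<And>x y. P x \<Longrightarrow> P y \<Longrightarrow> P (x * y)"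
  shows "P x"
proof -
  have "P (abs_ceps p)" for p :: "(epsgen \<Rightarrow>\<^sub>0 nat) \<Rightarrow>\<^sub>0 'c"
  proof (induction p rule: poly_induct)
    case (gen x)
    show ?case using assms(2,3) by (cases x) (simp_all add: theta.abs_eq eps.abs_eq)
  qed (use assms in \<open>simp_all flip: ceps_const.abs_eq plus_ceps.abs_eq times_ceps.abs_eq\<close>)
  then show ?thesis by (cases x rule: ceps_cases) simp
qed

lemma free_sigma_generated [case_names const E add mult]:
  fixes x :: "'c::comm_ring_1 free_sigma"
  assumes "\<And>c. P (sigma_const c)" "\<And>g n. P (sigma_E g n)"
    and "\<And>x y. P x \<Longrightarrow> P y \<Longrightarrow> P (x + y)" "\<And>x y. P x \<Longrightarrow> P y \<Longrightarrow> P (x * y)"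
  shows "P x"
proof -
  have "P (abs_free_sigma p)" for p :: "sigma_gen word \<Rightarrow>\<^sub>0 'c ceps"
  proof (induction p rule: word_alg_induct)
    case (gen x)
    show ?case using assms(2) by (cases x) (simp add: sigma_E_def)
  qed (use assms in \<open>simp_all flip: sigma_const_def plus_free_sigma.abs_eq times_free_sigma.abs_eq\<close>)
  then show ?thesis by (cases x rule: free_sigma_cases) simp
qed

text \<open>
  An element of a direct sum of copies of the integers modulo 2 is a finite set of indices.
\<close>

lemma surj_degrees: obtains d :: "nat \<Rightarrow> (nat \<Rightarrow>\<^sub>0 bit)" where "surj d"
proof -
  have "inj (keys :: (nat \<Rightarrow>\<^sub>0 bit) \<Rightarrow> nat set)"
  proof (rule injI, rule poly_mapping_eqI)
    fix g h :: "nat \<Rightarrow>\<^sub>0 bit" and i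
    assume "keys g = keys h"
    then have "(lookup g i = 0) = (lookup h i = 0)"
      by (metis in_keys_iff)
    then show "lookup g i = lookup h i" by (cases "lookup g i"; cases "lookup h i") simp_all
  qed
  moreover have "countable (range (keys :: (nat \<Rightarrow>\<^sub>0 bit) \<Rightarrow> nat set))"
    by (rule countable_subset [OF _ countable_Collect_finite]) auto
  ultimately have "countable (UNIV :: (nat \<Rightarrow>\<^sub>0 bit) set)"
    using countable_image_inj_on by blast
  then show ?thesis
    by (metis that range_from_nat_into UNIV_not_empty)
qed

text \<open>
  The odd generators of \<open>S\<close> enumerate the odd parts of the generators of \<open>\<SS>\<close>; the even ones
  enumerate the even parts together with \<open>\<theta>\<close> and all \<open>\<epsilon>\<^sub>i\<close>.
\<close>

lemma surjection_S_Sigma: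
  assumes two: "(2 :: 'c::comm_ring_1) dvd 1"
  obtains \<psi> :: "'c::comm_ring_1 free_scomm \<Rightarrow> 'c free_sigma" where
    "module_hom scale_S scale_Sigma \<psi>" "\<And>x y. \<psi> (x * y) = \<psi> x * \<psi> y" "surj \<psi>"
proof -
  obtain h :: 'c where h: "2 * h = 1" using two by (metis dvdE)
  define half where "half = ceps_const h"
  have half: "2 * half = 1"
    using h ceps_const_simps(2) [of 2 h] ceps_const_simps(1) [of "1 :: 'c" 1]
    by (simp add: half_def ceps_const_simps(3))
  define q where "q = parity_idem half"
  have idem: "q g * q g = q g" for g
    unfolding q_def by (rule parity_idem_idem [OF half])
  have exp: "exp_eps g h = 1 - 2 * q g * q h" for g h
    unfolding q_def by (rule exp_eps_parity_idem [OF half])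
  obtain d :: "nat \<Rightarrow> (nat \<Rightarrow>\<^sub>0 bit)" where d: "surj d" by (rule surj_degrees)
  \<comment> \<open>Even indices in the left summand code \<open>\<theta>\<close> (as 0) and \<open>\<epsilon>\<^sub>i\<close> (as \<open>Suc i\<close>).\<close>
  define G :: "sgen \<Rightarrow> 'c free_sigma" where "G = case_sgen
    (\<lambda>n. case sum_decode n of
        Inl k \<Rightarrow> sigma_const (case k of 0 \<Rightarrow> theta | Suc i \<Rightarrow> eps i)
      | Inr k \<Rightarrow> (case prod_decode k of (a, b) \<Rightarrow> sigma_const (1 - q (d a)) * sigma_E (d a) b))
    (\<lambda>n. case prod_decode n of (a, b) \<Rightarrow> sigma_const (q (d a)) * sigma_E (d a) b)"
  have G_even: "(\<exists>c. G (Even n) = sigma_const c) \<or> (\<exists>g m. G (Even n) = sigma_const (1 - q g) * sigma_E g m)" for n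
    by (auto simp: G_def split: sum.split prod.split)
  have G_odd: "\<exists>g m. G (Odd n) = sigma_const (q g) * sigma_E g m" for n
    by (auto simp: G_def split: prod.split)
  have const: "supercommute 0 j (sigma_const c) y" for j c and y :: "'c free_sigma"
    by (simp add: supercommute_def sigma_const.central [of c y])
  \<comment> \<open>The factor \<open>1 - q g\<close> kills \<open>q g\<close>, hence the sign; on \<open>q g * q h\<close> the sign is \<open>-1\<close>.\<close>
  have twist_even: "(1 - q g) * y * exp_eps g h = (1 - q g) * y" for g h y
  proof -
    have "(1 - q g) * y * exp_eps g h = (1 - q g) * y + (q g * q g - q g) * (2 * q h * y)"
      by (simp add: exp algebra_simps)
    then show ?thesis by (simp add: idem)
  qed
  have twist_odd: "q g * q h * exp_eps g h = - (q g * q h)" for g h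
  proof -
    have "q g * q h * exp_eps g h = q g * q h - 2 * (q g * q g) * (q h * q h)"
      by (simp add: exp algebra_simps)
    then show ?thesis by (simp add: idem mult.assoc)
  qed
  have even: "supercommute 0 j (G (Even n)) (sigma_const y * sigma_E h m)" for j n y h m
    using G_even [of n] const by (auto intro!: supercommute_weighted_E simp: twist_even)
  have odd: "supercommute 1 1 (sigma_const (q g) * sigma_E g n) (sigma_const (q h) * sigma_E h m)"
    for g h n m
    by (rule supercommute_weighted_E) (simp add: twist_odd)
  have "supercommute 0 0 (G (Even n)) (G (Even m))" for n m
    using G_even [of m] even supercommute_sym [OF const] by metis
  moreover have even_odd: "supercommute 0 1 (G (Even n)) (G (Odd m))" for n m
    using G_odd [of m] even by metis
  moreover have "supercommute 1 0 (G (Odd m)) (G (Even n))" for n m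
    by (rule supercommute_sym [OF even_odd])
  moreover have "supercommute 1 1 (G (Odd n)) (G (Odd m))" for n m
    using G_odd [of n] G_odd [of m] odd by metis
  ultimately have G: "supercommute (odd_count (Word [a])) (odd_count (Word [b])) (G a) (G b)" for a b
    by (cases a; cases b) simp_all
  interpret const: central_hom "\<lambda>c. sigma_const (ceps_const c) :: 'c free_sigma"
    by unfold_locales
      (simp_all add: ceps_const_simps sigma_const.add sigma_const.mult sigma_const.one,
        rule sigma_const.central)
  obtain \<psi> :: "'c free_scomm \<Rightarrow> 'c free_sigma" where add: "\<And>x y. \<psi> (x + y) = \<psi> x + \<psi> y"
    and mult: "\<And>x y. \<psi> (x * y) = \<psi> x * \<psi> y"
    and scale: "\<And>c x. \<psi> (scale_S c x) = sigma_const (ceps_const c) * \<psi> x"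
    and one: "\<psi> 1 = 1" and gen: "\<And>a. \<psi> (abs_free_scomm (gen a)) = G a"
    using const.free_scomm_lift [of G, OF G] by blast
  have "module_hom scale_S scale_Sigma \<psi>"
    using c_algebra.axioms(1) [OF c_algebra_scale_S] c_algebra.axioms(1) [OF c_algebra_scale_Sigma]
    by (intro module_hom.intro module_hom_axioms.intro) (simp_all add: add scale scale_Sigma_eq)
  moreover have "x \<in> range \<psi>" for x
  proof -
    have range_add: "x + y \<in> range \<psi>" and range_mult: "x * y \<in> range \<psi>"
      if "x \<in> range \<psi>" "y \<in> range \<psi>" for x y
      using that by (auto simp flip: add mult)
    have range_G: "G a \<in> range \<psi>" for a
      by (metis gen rangeI)
    have const: "sigma_const c \<in> range \<psi>" for c
    proof (induction c rule: ceps_generated)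
      case (const c)
      have "sigma_const (ceps_const c) = \<psi> (scale_S c 1)" by (simp add: scale one)
      then show ?case by simp
    next
      case theta
      then show ?case using range_G [of "Even (sum_encode (Inl 0))"] by (simp add: G_def)
    next
      case (eps i)
      then show ?case using range_G [of "Even (sum_encode (Inl (Suc i)))"] by (simp add: G_def)
    qed (simp_all add: sigma_const.add sigma_const.mult range_add range_mult)
    show ?thesis
    proof (induction x rule: free_sigma_generated)
      case (E g n)
      obtain a where g: "g = d a" using d by (metis surjD)
      have "sigma_const (1 - q g) * sigma_E g n \<in> range \<psi>"
        using range_G [of "Even (sum_encode (Inr (prod_encode (a, n))))"] by (simp add: G_def g)
      moreover have "sigma_const (q g) * sigma_E g n \<in> range \<psi>"
        using range_G [of "Odd (prod_encode (a, n))"] by (simp add: G_def g)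
      moreover have "sigma_E g n = sigma_const (1 - q g) * sigma_E g n + sigma_const (q g) * sigma_E g n"
        by (simp add: sigma_const.one flip: distrib_right sigma_const.add)
      ultimately show ?case using range_add by metis
    qed (simp_all add: const range_add range_mult)
  qed
  ultimately show ?thesis
    using that mult by blast
qed

section \<open>Adjoining a square root of two\<close>

text \<open>
  \<open>Ext a b\<close> is \<open>a + b\<theta>\<close> with \<open>\<theta>\<close> a central square root of \<open>2\<close>, adjoined formally even where \<open>2\<close> is
  already a square.
\<close>

datatype 'a sqrt2_ext = Ext (re: 'a) (im: 'a)

instantiation sqrt2_ext :: (ring_1) ring_1
begin

definition "0 = Ext 0 0"
definition "1 = Ext 1 0"
definition "x + y = Ext (re x + re y) (im x + im y)"
definition "- x = Ext (- re x) (- im x)"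
definition "x - y = Ext (re x - re y) (im x - im y)"
definition "x * y = Ext (re x * re y + 2 * (im x * im y)) (re x * im y + im x * re y)"

instance
  by standard (simp_all add: zero_sqrt2_ext_def one_sqrt2_ext_def plus_sqrt2_ext_def uminus_sqrt2_ext_def
      minus_sqrt2_ext_def times_sqrt2_ext_def mult_2 algebra_simps)

end

lemma Ext_simps:
  "Ext a b + Ext c d = Ext (a + c) (b + d)"
  "Ext a b * Ext c d = Ext (a * c + 2 * (b * d)) (a * d + b * c)"
  "- Ext a b = Ext (- a) (- b)"
  by (simp_all add: plus_sqrt2_ext_def times_sqrt2_ext_def uminus_sqrt2_ext_def)

definition scale_ext :: "('c \<Rightarrow> 'a \<Rightarrow> 'a) \<Rightarrow> 'c \<Rightarrow> 'a sqrt2_ext \<Rightarrow> 'a sqrt2_ext" where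
  "scale_ext s c x = Ext (s c (re x)) (s c (im x))"

lemma c_algebra_scale_ext:
  fixes s :: "'c::comm_ring_1 \<Rightarrow> 'a::ring_1 \<Rightarrow> 'a"
  assumes "c_algebra s"
  shows "c_algebra (scale_ext s)"
proof -
  interpret c_algebra s by fact
  show ?thesis
    by unfold_locales
      (simp_all add: scale_ext_def plus_sqrt2_ext_def times_sqrt2_ext_def mult_2 scale_left_distrib
        scale_right_distrib scale_mult_left scale_mult_right)
qed

context central_hom
begin

text \<open>
  When \<open>\<theta>\<close> and every \<open>\<epsilon>\<^sub>i\<close> go to the same square root \<open>t\<close> of \<open>2\<close>, the relation \<open>\<theta>\<^sup>2 = 2\<close> becomes
  \<open>t * t = 2\<close> and the others become \<open>t * t = t * t\<close>.  A monomial goes to the power of \<open>t\<close> given by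
  its degree.
\<close>

lemma ceps_lift:
  assumes t: "t * t = 2" "\<And>x. t * x = x * t"
  obtains \<phi> :: "'r ceps \<Rightarrow> 't" where "central_hom \<phi>"
    "\<And>c. \<phi> (ceps_const c) = f c" "\<phi> theta = t" "\<And>i. \<phi> (eps i) = t"
proof -
  define deg :: "(epsgen \<Rightarrow>\<^sub>0 nat) \<Rightarrow> nat" where "deg m = (\<Sum>i\<in>keys m. lookup m i)" for m
  have deg_add: "deg (m + n) = deg m + deg n" for m n
    unfolding deg_def by (rule setsum_keys_plus_distrib) simp_all
  let ?h = "hom_ext (\<lambda>m. t ^ deg m)"
  define \<phi> where "\<phi> x = ?h (rep_ceps x)" for x
  have deg_simps [simp]: "deg 0 = 0" "deg (single x n) = n" for x n
    by (simp_all add: deg_def)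
  have hmult: "?h (p * q) = ?h p * ?h q" for p q
    by (rule hom_ext_mult) (simp add: deg_add power_add)
  have hgen: "?h (single (single x 1) 1) = t" for x
    by (simp add: lin_ext_single one)
  have hone: "?h 1 = 1"
    by (rule hom_ext_one) simp
  have "?h 2 = 2"
    using lin_ext_add [of "\<lambda>m. t ^ deg m" 1 1] by (simp add: hone)
  then have rel: "?h r = 0" if "r \<in> ceps_relations" for r
    using that by (auto simp: ceps_relations_def power2_eq_square lin_ext_diff hmult hgen t(1) simp del: One_nat_def)
  have abs: "\<phi> (abs_ceps p) = ?h p" for p
    unfolding \<phi>_def
    by (rule hom_ideal_cong [OF lin_ext_add hmult rel rep_abs_ceps])
  have "t ^ n * x = x * t ^ n" for n x
  proof (induction n)
    case (Suc n)
    have "t ^ Suc n * x = t * (t ^ n * x)" by (simp add: mult.assoc)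
    also have "\<dots> = t * x * t ^ n" by (simp only: Suc mult.assoc)
    also have "\<dots> = x * t ^ Suc n" by (simp only: t(2) [of x] mult.assoc power_Suc)
    finally show ?case .
  qed simp
  then have "f c * t ^ n * x = x * (f c * t ^ n)" for c n x
    by (metis central mult.assoc)
  then have hcentral: "?h p * x = x * ?h p" for p x
    by (simp add: lin_ext_def sum_distrib_left sum_distrib_right)
  have "central_hom \<phi>"
  proof
    fix c d :: "'r ceps" and x :: 't
    obtain p q where cd: "c = abs_ceps p" "d = abs_ceps q" by (metis ceps_cases)
    show "\<phi> (c + d) = \<phi> c + \<phi> d" by (simp add: cd plus_ceps.abs_eq abs lin_ext_add)
    show "\<phi> (c * d) = \<phi> c * \<phi> d" by (simp add: cd times_ceps.abs_eq abs hmult)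
    show "\<phi> 1 = 1" by (simp add: one_ceps.abs_eq abs hone)
    show "\<phi> c * x = x * \<phi> c" by (simp add: cd abs hcentral)
  qed
  then show ?thesis
    by (rule that) (simp_all add: ceps_const.abs_eq theta.abs_eq eps.abs_eq abs lin_ext_single one)
qed

end

lemma free_sigma_lift:
  fixes f :: "'c::comm_ring_1 ceps \<Rightarrow> 't::ring_1"
  assumes f: "central_hom f"
    and gen: "\<And>g h n m. G h m * G g n = f (exp_eps g h) * (G g n * G h m)"
  obtains \<phi> :: "'c free_sigma \<Rightarrow> 't" where
    "\<And>x y. \<phi> (x + y) = \<phi> x + \<phi> y" "\<And>x y. \<phi> (x * y) = \<phi> x * \<phi> y"
    "\<And>c. \<phi> (sigma_const c) = f c" "\<And>g n. \<phi> (sigma_E g n) = G g n"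
proof
  interpret central_hom f by (rule f)
  let ?G = "\<lambda>a. case a of E g n \<Rightarrow> G g n"
  let ?h = "hom_ext (word_prod ?G)"
  define \<phi> where "\<phi> x = ?h (rep_free_sigma x)" for x
  have hmult: "?h (p * q) = ?h p * ?h q" for p q
    by (rule hom_ext_mult) (rule word_prod_add)
  have hconst: "?h (single 0 c) = f c" for c
    by (rule hom_ext_scalar) (rule word_prod_0)
  have hgen: "?h (gen (E g n)) = G g n" for g n
    by (simp add: lin_ext_single one)
  have rel: "?h r = 0" if r: "r \<in> sigma_relations" for r
  proof -
    obtain g h n m where "r = gen (E g n) * gen (E h m) - gen (E h m) * gen (E g n)
        - single 0 (1 - exp_eps g h) * (gen (E g n) * gen (E h m))"
      using r unfolding sigma_relations_def by blast
    then show ?thesis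
      by (simp only: lin_ext_diff hmult hgen hconst) (simp add: gen [of h m g n] diff one algebra_simps)
  qed
  have abs: "\<phi> (abs_free_sigma p) = ?h p" for p
    unfolding \<phi>_def
    by (rule hom_ideal_cong [OF lin_ext_add hmult rel rep_abs_free_sigma])
  show "\<phi> (x + y) = \<phi> x + \<phi> y" for x y
    by (cases x rule: free_sigma_cases; cases y rule: free_sigma_cases)
      (simp add: plus_free_sigma.abs_eq abs lin_ext_add)
  show "\<phi> (x * y) = \<phi> x * \<phi> y" for x y
    by (cases x rule: free_sigma_cases; cases y rule: free_sigma_cases)
      (simp add: times_free_sigma.abs_eq abs hmult)
  show "\<phi> (sigma_const c) = f c" for c
    by (simp add: sigma_const_def abs hconst)
  show "\<phi> (sigma_E g n) = G g n" for g n
    by (simp add: sigma_E_def abs hgen)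
qed

text \<open>
  Each \<open>1 - \<epsilon>\<^sub>i\<epsilon>\<^sub>j\<close> goes to \<open>1 - 2 = -1\<close>, so the defining relations of \<open>\<SS>\<close> become
  supercommutation of generators of \<open>S\<close>.
\<close>

lemma surjection_Sigma_ext:
  obtains \<eta> :: "'c::comm_ring_1 free_sigma \<Rightarrow> 'c free_scomm sqrt2_ext" where
    "module_hom scale_Sigma (scale_ext scale_S) \<eta>" "\<And>x y. \<eta> (x * y) = \<eta> x * \<eta> y" "surj \<eta>"
proof -
  interpret S: c_algebra "scale_S :: 'c \<Rightarrow> 'c free_scomm \<Rightarrow> 'c free_scomm"
    by (rule c_algebra_scale_S)
  define t :: "'c free_scomm sqrt2_ext" where "t = Ext 0 1"
  define scalar :: "'c \<Rightarrow> 'c free_scomm sqrt2_ext" where "scalar c = Ext (scale_S c 1) 0" for c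
  have t: "t * t = 2" "t * x = x * t" for x
    using one_add_one [where 'a = "'c free_scomm sqrt2_ext"]
    by (simp_all add: t_def times_sqrt2_ext_def one_sqrt2_ext_def plus_sqrt2_ext_def)
  interpret scalar: central_hom scalar
    by unfold_locales
      (simp_all add: scalar_def Ext_simps S.scale_left_distrib one_sqrt2_ext_def times_sqrt2_ext_def
        S.scale_mult_left S.scale_mult_right mult.commute)
  have scale: "scale_ext scale_S c x = scalar c * x" for c x
    by (simp add: scale_ext_def scalar_def times_sqrt2_ext_def S.scale_mult_left)
  obtain f :: "'c ceps \<Rightarrow> 'c free_scomm sqrt2_ext" where f: "central_hom f"
    "\<And>c. f (ceps_const c) = scalar c" "f theta = t" "\<And>i. f (eps i) = t"
    using scalar.ceps_lift [OF t] by metis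
  interpret f: central_hom f by (rule f)
  have prod_const: "f (\<Prod>i\<in>I. x i) = y ^ card I" if "\<And>i. f (x i) = y" for I :: "nat set" and x y
    by (induction I rule: infinite_finite_induct) (simp_all add: f.one f.mult that)
  have "f (1 - eps i * eps j) = - 1" for i j
    by (simp add: f.diff f.one f.mult f(4) t(1))
  then have exp: "f (exp_eps g h) = (-1) ^ (card (support h) * card (support g))" for g h
    unfolding exp_eps_def support_def by (simp add: prod_const power_mult)
  define x :: "sgen \<Rightarrow> 'c free_scomm" where "x a = abs_free_scomm (gen a)" for a
  define G where "G g n = Ext (x (if odd (card (support g)) then Odd n else Even n)) 0" for g n
  have G: "G h m * G g n = f (exp_eps g h) * (G g n * G h m)" for g h n m
    using supercommute_generators [of "if odd (card (support h)) then Odd m else Even m"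
        "if odd (card (support g)) then Odd n else Even n", where 'c = 'c]
    by (cases "odd (card (support h))"; cases "odd (card (support g))")
      (simp_all add: G_def exp x_def supercommute_def Ext_simps minus_one_power_iff)
  obtain \<eta> :: "'c free_sigma \<Rightarrow> 'c free_scomm sqrt2_ext" where
    add: "\<And>x y. \<eta> (x + y) = \<eta> x + \<eta> y" and mult: "\<And>x y. \<eta> (x * y) = \<eta> x * \<eta> y"
    and const: "\<And>c. \<eta> (sigma_const c) = f c" and E: "\<And>g n. \<eta> (sigma_E g n) = G g n"
    using free_sigma_lift [of f G, OF f(1) G] by blast
  have "module_hom scale_Sigma (scale_ext scale_S) \<eta>"
    using c_algebra.axioms(1) [OF c_algebra_scale_ext [OF c_algebra_scale_S]]
      c_algebra.axioms(1) [OF c_algebra_scale_Sigma]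
    by (intro module_hom.intro module_hom_axioms.intro) (simp_all add: add scale scale_Sigma_eq mult const f(2))
  moreover have "y \<in> range \<eta>" for y
  proof -
    have range_add: "y + z \<in> range \<eta>" and range_mult: "y * z \<in> range \<eta>"
      if "y \<in> range \<eta>" "z \<in> range \<eta>" for y z
      using that by (auto simp flip: add mult)
    have "Ext (abs_free_scomm p) 0 \<in> range \<eta>" for p :: "sgen word \<Rightarrow>\<^sub>0 'c"
    proof (induction p rule: word_alg_induct)
      case (scalar c)
      have "single 0 c = fscale c (1 :: sgen word \<Rightarrow>\<^sub>0 'c)"
        by (simp add: fscale_single flip: single_one)
      then have "Ext (abs_free_scomm (single 0 c)) 0 = \<eta> (sigma_const (ceps_const c))"
        by (simp add: const f(2) scalar_def one_free_scomm.abs_eq scale_S_abs)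
      then show ?case by simp
    next
      case (gen a)
      \<comment> \<open>The unit \<open>1\<close> of \<open>nat \<Rightarrow>\<^sub>0 bit\<close> is the degree with the single bit at index 0 set.\<close>
      have "support 0 = {}" "support 1 = {0}"
        by (auto simp: support_def lookup_one when_def split: if_splits)
      then have "Ext (x a) 0 = \<eta> (case a of Even n \<Rightarrow> sigma_E 0 n | Odd n \<Rightarrow> sigma_E 1 n)"
        by (simp add: E G_def split: sgen.split)
      then show ?case by (simp add: x_def)
    next
      case (add p q)
      have "Ext (abs_free_scomm (p + q)) 0 = Ext (abs_free_scomm p) 0 + Ext (abs_free_scomm q) 0"
        by (simp add: Ext_simps plus_free_scomm.abs_eq)
      then show ?case using range_add [OF add] by (simp only:)
    next
      case (mult p q)
      have "Ext (abs_free_scomm (p * q)) 0 = Ext (abs_free_scomm p) 0 * Ext (abs_free_scomm q) 0"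
        by (simp add: Ext_simps times_free_scomm.abs_eq)
      then show ?case using range_mult [OF mult] by (simp only:)
    qed
    then have S: "Ext a 0 \<in> range \<eta>" for a
      by (metis free_scomm_cases)
    have "t \<in> range \<eta>"
      using const [of theta] f(3) by (metis rangeI)
    then have "Ext (re y) 0 + Ext (im y) 0 * t \<in> range \<eta>"
      by (intro range_add range_mult S)
    then show ?thesis by (simp add: t_def Ext_simps)
  qed
  ultimately show ?thesis
    using that mult by blast
qed

theorem theorem3p24:
  fixes scale_A :: "'c::comm_ring_1 \<Rightarrow> 'a::ring \<Rightarrow> 'a" and tr :: "'a \<Rightarrow> 'a"
  assumes "(2 :: 'c) dvd 1"
    and "algebra_trace scale_A tr"
  shows "lin_identities (tensor scale_A scale_S) (tensor_map_left scale_A scale_S tr) =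
         lin_identities (tensor scale_A scale_Sigma) (tensor_map_left scale_A scale_Sigma tr)"
proof (rule equalityI)
  have A: "c_algebra scale_A" and tr: "module_hom scale_A scale_A tr"
    using assms(2) by (simp_all add: algebra_trace_def)
  note ext = c_algebra_scale_ext [OF c_algebra_scale_S]
  obtain \<psi> :: "'c free_scomm \<Rightarrow> 'c free_sigma" where
    "module_hom scale_S scale_Sigma \<psi>" "\<And>x y. \<psi> (x * y) = \<psi> x * \<psi> y" "surj \<psi>"
    by (rule surjection_S_Sigma [OF assms(1)], rule that)
  from lin_identities_surj [OF A c_algebra_scale_S c_algebra_scale_Sigma tr this]
  show "lin_identities (tensor scale_A scale_S) (tensor_map_left scale_A scale_S tr) \<subseteq>
      lin_identities (tensor scale_A scale_Sigma) (tensor_map_left scale_A scale_Sigma tr)" .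
  obtain \<eta> :: "'c free_sigma \<Rightarrow> 'c free_scomm sqrt2_ext" where
    "module_hom scale_Sigma (scale_ext scale_S) \<eta>" "\<And>x y. \<eta> (x * y) = \<eta> x * \<eta> y" "surj \<eta>"
    by (rule surjection_Sigma_ext, rule that)
  from lin_identities_surj [OF A c_algebra_scale_Sigma ext tr this]
  have "lin_identities (tensor scale_A scale_Sigma) (tensor_map_left scale_A scale_Sigma tr) \<subseteq>
      lin_identities (tensor scale_A (scale_ext scale_S)) (tensor_map_left scale_A (scale_ext scale_S) tr)" .
  also have "\<dots> \<subseteq> lin_identities (tensor scale_A scale_S) (tensor_map_left scale_A scale_S tr)"
  proof (rule lin_identities_split [where \<psi> = "\<lambda>x. Ext x 0" and \<rho> = re, OF A c_algebra_scale_S ext tr])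
    show "module_hom (scale_ext scale_S) scale_S re"
      using c_algebra.axioms(1) [OF ext] c_algebra.axioms(1) [OF c_algebra_scale_S]
      by (intro module_hom.intro module_hom_axioms.intro)
        (simp_all add: scale_ext_def plus_sqrt2_ext_def)
  qed (simp_all add: Ext_simps)
  finally show "lin_identities (tensor scale_A scale_Sigma) (tensor_map_left scale_A scale_Sigma tr) \<subseteq>
      lin_identities (tensor scale_A scale_S) (tensor_map_left scale_A scale_S tr)" .
qed

end
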